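(* Assume that for all $k\ge 2$ one has $\lambda_1\ge\lambda_k$ and $3\alpha_1<\alpha_k$. Then for any fixed $T>0$ there exists a minimizer $y^*\in C([0,T];H)$ satisfying $$I(y^* )=\inf\{I(y): y\in C([0,T];H),\ y(0)=0,\ \exists\, 0\le t\le T \text{ with } |y(t)|_H=L\}.$$ The minimizer $y^*$ has the property that $|y^*(t)|_H<L$ for all $t<T$ and $|y^*(T)|_H=L$. Furthermore, $y^*$ only points in the $e_1$ direction, that is, $\langle y^*(t),e_k\rangle_H=0$ for all $t\in[0,T]$ and all $k\ge2$.
   Context: $H=L^2(\mathcal O)$, with $\mathcal O\subset\mathbb R^d$ a bounded regular domain, inner product $\langle\cdot,\cdot\rangle_H$ and norm $|\cdot|_H$; $(e_k)_{k\ge1}$ is a complete orthonormal basis of $H$. $A$ is an unbounded self-adjoint operator on $H$ with $Ae_k=-\alpha_ke_k$, $0<\alpha_1\le\alpha_2\le\cdots$, generating the semigroup $e^{tA}e_k=e^{-\alpha_kt}e_k$. $B:H\to H$ is bounded with $Be_k=\lambda_ke_k$, $\lambda_k>0$. It is assumed throughout that $\sum_{k\ge1}\lambda_k^2/\alpha_k<\infty$. $L>0$ is fixed. Let $u(x)=\frac{2\alpha_1}{\lambda_1}\langle x,e_1\rangle_He_1$. For $v\in L^2([0,T];H)$ let $X^v$ be the mild solution on $[0,T]$ of $dX^v(t)=[AX^v(t)-Bu(X^v(t))+Bv(t)]\,dt$, $X^v(0)=0$, i.e. $X^v(t)=\int_0^te^{(t-s)A}B\,(v(s)-u(X^v(s)))\,ds$.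 Let $\tau=\inf\{t>0:|X^v(t)|_H\ge L\}$. The functional $I$ is $$I(X^v)=\int_0^\tau\Big(\tfrac12|v(s)|_H^2-|u(X^v(s))|_H^2\Big)ds,$$ (the control $v$ is uniquely determined by the path $X^v$), and $I(y)=+\infty$ if $y$ with $y(0)=0$ is not of the form $X^v$ for any $v\in L^2([0,T];H)$. *)

theory Defs
  imports "HOL-Analysis.Analysis"
begin

text \<open>
  The Hilbert space $H = L^2(\mathcal O)$ enters only through its Hilbert space structure, so $H$ is
  an arbitrary type of class real_inner, banach and second_countable_topology, i.e. a real
  separable Hilbert space; all sequences indexed by $k \ge 1$ are functions on nat whose value at 0
  is irrelevant.
\<close>

definition complete_orthonormal_basis :: "(nat \<Rightarrow> 'a::real_inner) \<Rightarrow> bool" where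
  "complete_orthonormal_basis e \<longleftrightarrow>
     (\<forall>j\<ge>1. \<forall>k\<ge>1. e j \<bullet> e k = (if j = k then 1 else 0)) \<and>
     closure (span (e ` {1..})) = UNIV"

text \<open>
  A partially defined operator is a total function A together with its domain D; values of A
  outside D are irrelevant.  The last conjunct says that the graph of the adjoint is the graph
  of A.
\<close>

definition self_adjoint_op :: "'a::real_inner set \<Rightarrow> ('a \<Rightarrow> 'a) \<Rightarrow> bool" where
  "self_adjoint_op D A \<longleftrightarrow>
     subspace D \<and> closure D = UNIV \<and>
     (\<forall>x\<in>D. \<forall>y\<in>D. A (x + y) = A x + A y) \<and>
     (\<forall>c. \<forall>x\<in>D. A (c *\<^sub>R x) = c *\<^sub>R A x) \<and>
     (\<forall>y z. (\<forall>x\<in>D. A x \<bullet> y = x \<bullet> z) \<longleftrightarrow> (y \<in> D \<and> z = A y))"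

definition unbounded_op :: "'a::real_normed_vector set \<Rightarrow> ('a \<Rightarrow> 'a) \<Rightarrow> bool" where
  "unbounded_op D A \<longleftrightarrow> \<not> (\<exists>C. \<forall>x\<in>D. norm (A x) \<le> C * norm x)"

text \<open>
  The family S is the strongly continuous semigroup $e^{tA}$, $t \ge 0$, with infinitesimal
  generator A; the last conjunct identifies both the domain and the values of the generator.
\<close>

definition generates_semigroup ::
    "'a::real_normed_vector set \<Rightarrow> ('a \<Rightarrow> 'a) \<Rightarrow> (real \<Rightarrow> 'a \<Rightarrow> 'a) \<Rightarrow> bool" where
  "generates_semigroup D A S \<longleftrightarrow>
     (\<forall>t\<ge>0. bounded_linear (S t)) \<and>
     (\<forall>x. S 0 x = x) \<and>
     (\<forall>s\<ge>0. \<forall>t\<ge>0. \<forall>x. S (s + t) x = S s (S t x)) \<and>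
     (\<forall>x. ((\<lambda>t. S t x) \<longlongrightarrow> x) (at_right 0)) \<and>
     (\<forall>x y. ((\<lambda>t. (S t x - x) /\<^sub>R t) \<longlongrightarrow> y) (at_right 0) \<longleftrightarrow> (x \<in> D \<and> y = A x))"

definition L2_control :: "real \<Rightarrow> (real \<Rightarrow> 'a::{real_normed_vector, second_countable_topology}) \<Rightarrow> bool"
  where
  "L2_control T v \<longleftrightarrow>
     set_borel_measurable lborel {0..T} v \<and>
     set_integrable lborel {0..T} (\<lambda>s. (norm (v s))\<^sup>2)"

text \<open>
  Only the restrictions of v and X to $[0,T]$ matter.  Continuity of X guarantees that the integrand
  is Bochner integrable, so the default value 0 of the integral is never used.
\<close>

definition mild_solution ::
    "real \<Rightarrow> (real \<Rightarrow> 'a \<Rightarrow> 'a) \<Rightarrow> ('a \<Rightarrow> 'a) \<Rightarrow> ('a \<Rightarrow> 'a) \<Rightarrow> (real \<Rightarrow> 'a) \<Rightarrow>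
      (real \<Rightarrow> 'a::{real_inner, banach, second_countable_topology}) \<Rightarrow> bool" where
  "mild_solution T S B u v X \<longleftrightarrow>
     continuous_on {0..T} X \<and>
     (\<forall>t\<in>{0..T}. X t = (LINT s:{0..t}|lborel. S (t - s) (B (v s - u (X s)))))"

text \<open>The exit time is $\infty$ if the path does not reach norm L during $(0,T]$.\<close>

definition exit_time :: "real \<Rightarrow> real \<Rightarrow> (real \<Rightarrow> 'a::real_normed_vector) \<Rightarrow> ereal" where
  "exit_time T L y = (INF t\<in>{t. 0 < t \<and> t \<le> T \<and> L \<le> norm (y t)}. ereal t)"

text \<open>
  The integral from 0 to the exit time; paths live on $[0,T]$, so it stops at T when the exit time
  is $\infty$.
\<close>

definition path_cost ::
    "real \<Rightarrow> real \<Rightarrow> ('a \<Rightarrow> 'a) \<Rightarrow> (real \<Rightarrow> 'a) \<Rightarrow> (real \<Rightarrow> 'a::real_normed_vector) \<Rightarrow> real" where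
  "path_cost T L u v X =
     (LINT s:{s. 0 \<le> s \<and> s \<le> T \<and> ereal s \<le> exit_time T L X}|lborel.
        (norm (v s))\<^sup>2 / 2 - (norm (u (X s)))\<^sup>2)"

text \<open>
  The control v producing a given path is unique up to null sets, and path_cost depends on v only
  up to null sets, so the choice made by SOME is immaterial.
\<close>

definition rate_functional ::
    "real \<Rightarrow> real \<Rightarrow> (real \<Rightarrow> 'a \<Rightarrow> 'a) \<Rightarrow> ('a \<Rightarrow> 'a) \<Rightarrow> ('a \<Rightarrow> 'a) \<Rightarrow>
      (real \<Rightarrow> 'a::{real_inner, banach, second_countable_topology}) \<Rightarrow> ereal" where
  "rate_functional T L S B u y =
     (if \<exists>v. L2_control T v \<and> mild_solution T S B u v y
      then ereal (path_cost T L u (SOME v. L2_control T v \<and> mild_solution T S B u v y) y)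
      else \<infinity>)"

definition exit_paths :: "real \<Rightarrow> real \<Rightarrow> (real \<Rightarrow> 'a::real_normed_vector) set" where
  "exit_paths T L = {y. continuous_on {0..T} y \<and> y 0 = 0 \<and> (\<exists>t\<in>{0..T}. norm (y t) = L)}"

end

theory Submission imports Defs begin

text \<open>
  In the eigenbasis the controlled equation decouples. Write $x_k$ and $v_k$ for the coordinates of
  $X$ and $v$, and $w_k = \lambda_k (v_k - u_k(X))$ for the forcing of the $k$-th mode, so that
  $x_k' = -\alpha_k x_k + w_k$ with $x_k(0) = 0$. The feedback $u$ acts in the first mode only, and
  there completing the square gives
  $$\lambda_1^2 \bigl(v_1^2/2 - |u(X)|^2\bigr) = w_1^2/2 + 2 \alpha_1 x_1 (w_1 - \alpha_1 x_1)
     = w_1^2/2 + \alpha_1 (x_1^2)'.$$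
  Hence the negative term of the cost integrates to a boundary term, and only the energy of the
  forcings remains to be minimized. By Cauchy--Schwarz, the energy $\frac12 \int w_k^2$ needed to
  bring mode $k$ from $0$ to $z$ in time $\tau$ is at least $\alpha_k z^2 / (1 - e^{-2 \alpha_k \tau})$.

  With $c(\tau) = \lambda_1^{-2} \bigl(\alpha_1/(1 - e^{-2\alpha_1\tau}) + \alpha_1\bigr)$ the first mode
  therefore costs at least $c(\tau) x_1(\tau)^2$. The gap $\alpha_k \ge 3 \alpha_1$ is what makes
  $\alpha_k / (1 - e^{-2 \alpha_k \tau})$ at least $\alpha_1/(1 - e^{-2\alpha_1\tau}) + \alpha_1$, so that,
  since $\lambda_k \le \lambda_1$, every other mode costs at least $c(\tau) x_k(\tau)^2$ as well. Summing
  with Bessel's inequality for $v$ and Parseval's identity for $X(\tau)$ bounds the cost of an exit at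
  time $\tau \le T$ below by $c(\tau) L^2 \ge c(T) L^2$; the last step holds because $c$ is decreasing.

  Equality in Cauchy--Schwarz forces $w_1(s)$ to be proportional to $e^{\alpha_1 s}$, which gives the path
  $L \sinh(\alpha_1 t)/\sinh(\alpha_1 T)\, e_1$. It stays inside the ball before time $T$ and costs
  exactly $c(T) L^2$. As the rate functional evaluates the cost at an arbitrary control that generates
  the path, this value has to be computed for all such controls; Lebesgue differentiation shows that
  they agree almost everywhere.
\<close>

section \<open>Integrals on a time interval\<close>

text \<open>The multipliers that occur below, exponentials and coordinates of continuous paths, are bounded on
  compact intervals.\<close>

lemma set_integrable_continuous_mult:
  fixes f :: "real \<Rightarrow> real"
  assumes phi: "continuous_on {a..b} \<phi>" and f: "set_integrable lborel {a..b} f"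
  shows "set_integrable lborel {a..b} (\<lambda>s. \<phi> s * f s)"
proof -
  have "compact (\<phi> ` {a..b})"
    using phi by (intro compact_continuous_image) auto
  then obtain K where K: "\<And>s. s \<in> {a..b} \<Longrightarrow> \<bar>\<phi> s\<bar> \<le> K"
    unfolding compact_eq_bounded_closed bounded_iff by (metis imageI real_norm_def)
  have m1: "set_borel_measurable lborel {a..b} \<phi>"
    using set_measurable_continuous_on[OF _ phi] by (simp add: set_borel_measurable_def)
  have "(\<lambda>s. (indicat_real {a..b} s *\<^sub>R \<phi> s) * (indicat_real {a..b} s *\<^sub>R f s)) \<in> borel_measurable lborel"
    using m1 f unfolding set_borel_measurable_def set_integrable_def
    by (intro borel_measurable_times) auto
  also have "(\<lambda>s. (indicat_real {a..b} s *\<^sub>R \<phi> s) * (indicat_real {a..b} s *\<^sub>R f s))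
      = (\<lambda>s. indicat_real {a..b} s *\<^sub>R (\<phi> s * f s))"
    by (auto simp: indicator_def)
  finally have "set_borel_measurable lborel {a..b} (\<lambda>s. \<phi> s * f s)"
    unfolding set_borel_measurable_def .
  moreover have "set_integrable lborel {a..b} (\<lambda>s. K * f s)"
    using f by simp
  moreover have "AE s in lborel. s \<in> {a..b} \<longrightarrow> norm (\<phi> s * f s) \<le> norm (K * f s)"
  proof (intro AE_I2 impI)
    fix s assume "s \<in> {a..b}"
    then have "\<bar>\<phi> s\<bar> \<le> \<bar>K\<bar>"
      using K[of s] by simp
    then show "norm (\<phi> s * f s) \<le> norm (K * f s)"
      by (simp add: abs_mult mult_right_mono)
  qed
  ultimately show ?thesis
    using set_integrable_bound by blast
qed

text \<open>Integration by parts for antiderivatives of integrable functions, which are differentiable only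
  almost everywhere. The product of the two integrals is an integral of $f(s) g(t)$ over a square;
  the square is cut along its diagonal, and Fubini's theorem is applied to each triangle.\<close>

lemma product_of_integrals:
  fixes f g :: "real \<Rightarrow> real"
  assumes f: "set_integrable lborel {0..T} f" and g: "set_integrable lborel {0..T} g"
    and F: "\<And>t. 0 \<le> t \<Longrightarrow> t \<le> T \<Longrightarrow> F t = (LINT s:{0..t}|lborel. f s)"
    and G: "\<And>t. 0 \<le> t \<Longrightarrow> t \<le> T \<Longrightarrow> G t = (LINT s:{0..t}|lborel. g s)"
    and T: "0 \<le> T"
  shows "F T * G T = (LINT t:{0..T}|lborel. F t * g t) + (LINT t:{0..T}|lborel. f t * G t)"
proof -
  define f' where "f' = (\<lambda>s. indicat_real {0..T} s *\<^sub>R f s)"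
  define g' where "g' = (\<lambda>s. indicat_real {0..T} s *\<^sub>R g s)"
  have f': "integrable lborel f'" and g': "integrable lborel g'"
    using f g unfolding f'_def g'_def set_integrable_def by auto
  note [measurable] = borel_measurable_integrable[OF f'] borel_measurable_integrable[OF g']
  define h where "h = (\<lambda>(s, t). f' s * g' t)"
  have h: "integrable (lborel \<Otimes>\<^sub>M lborel) h"
  proof (rule lborel_pair.Fubini_integrable)
    show "h \<in> borel_measurable (lborel \<Otimes>\<^sub>M lborel)"
      unfolding h_def by measurable
    show "integrable lborel (\<lambda>x. LINT y|lborel. norm (h (x, y)))"
      unfolding h_def using f' by (simp add: abs_mult)
    show "AE x in lborel. integrable lborel (\<lambda>y. h (x, y))"
      unfolding h_def using g' by simp
  qed
  define h1 where "h1 = (\<lambda>(s, t). if s \<le> t then f' s * g' t else 0)"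
  define h2 where "h2 = (\<lambda>(s, t). if t < s then f' s * g' t else 0)"
  have h1: "integrable (lborel \<Otimes>\<^sub>M lborel) h1"
    by (rule Bochner_Integration.integrable_bound[OF h])
      (auto simp: h1_def h_def)
  have h2: "integrable (lborel \<Otimes>\<^sub>M lborel) h2"
    by (rule Bochner_Integration.integrable_bound[OF h])
      (auto simp: h2_def h_def)
  have FT: "F T = (LINT s|lborel. f' s)" and GT: "G T = (LINT s|lborel. g' s)"
    using T by (simp_all add: F G f'_def g'_def set_lebesgue_integral_def)
  have "F T * G T = (LINT x|lborel. LINT y|lborel. h (x, y))"
    unfolding FT GT h_def by simp
  also have "\<dots> = integral\<^sup>L (lborel \<Otimes>\<^sub>M lborel) h"
    by (rule lborel_pair.integral_fst'[OF h])
  also have "h = (\<lambda>x. h1 x + h2 x)"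
    by (auto simp: h_def h1_def h2_def)
  also have "integral\<^sup>L (lborel \<Otimes>\<^sub>M lborel) \<dots> =
      integral\<^sup>L (lborel \<Otimes>\<^sub>M lborel) h1 + integral\<^sup>L (lborel \<Otimes>\<^sub>M lborel) h2"
    by (rule Bochner_Integration.integral_add[OF h1 h2])
  also have "integral\<^sup>L (lborel \<Otimes>\<^sub>M lborel) h1 = (LINT t|lborel. LINT s|lborel. h1 (s, t))"
  proof -
    have "integrable (lborel \<Otimes>\<^sub>M lborel) (\<lambda>(s, t). h1 (s, t))"
      using h1 by simp
    from lborel_pair.integral_snd[OF this] show ?thesis by simp
  qed
  also have "(\<lambda>t. LINT s|lborel. h1 (s, t)) = (\<lambda>t. indicat_real {0..T} t *\<^sub>R (F t * g t))"
  proof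
    fix t
    have "(LINT s|lborel. h1 (s, t)) = (LINT s|lborel. (indicat_real {0..t} s *\<^sub>R f s) * g' t)"
      unfolding h1_def by (rule Bochner_Integration.integral_cong) (auto simp: f'_def g'_def indicator_def)
    then show "(LINT s|lborel. h1 (s, t)) = indicat_real {0..T} t *\<^sub>R (F t * g t)"
      by (auto simp: F g'_def set_lebesgue_integral_def indicator_def)
  qed
  also have "integral\<^sup>L (lborel \<Otimes>\<^sub>M lborel) h2 = (LINT s|lborel. LINT t|lborel. h2 (s, t))"
    by (rule lborel_pair.integral_fst'[OF h2, symmetric])
  also have "(\<lambda>s. LINT t|lborel. h2 (s, t)) = (\<lambda>s. indicat_real {0..T} s *\<^sub>R (f s * G s))"
  proof
    fix s
    have "(LINT t|lborel. h2 (s, t)) = (LINT t|lborel. f' s * (indicat_real {0..s} t *\<^sub>R g t))"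
    proof (rule integral_cong_AE)
      show "AE t in lborel. h2 (s, t) = f' s * (indicat_real {0..s} t *\<^sub>R g t)"
        \<comment> \<open>The triangle is open at the diagonal, whereas \<open>G\<close> integrates over a closed interval.\<close>
        using AE_lborel_singleton[of s]
        by eventually_elim (auto simp: h2_def f'_def g'_def indicator_def)
      show "(\<lambda>t. h2 (s, t)) \<in> borel_measurable lborel"
      proof -
        have "(\<lambda>t. h2 (s, t)) = (\<lambda>t. indicat_real {..<s} t * (f' s * g' t))"
          by (auto simp: h2_def indicator_def)
        also have "\<dots> \<in> borel_measurable lborel" by measurable
        finally show ?thesis .
      qed
      have "(\<lambda>t. f' s * (indicat_real {0..s} t *\<^sub>R g t)) =
          (\<lambda>t. f' s * (indicat_real {0..s} t *\<^sub>R g' t))"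
        by (auto simp: f'_def g'_def indicator_def)
      also have "\<dots> \<in> borel_measurable lborel" by measurable
      finally show "(\<lambda>t. f' s * (indicat_real {0..s} t *\<^sub>R g t)) \<in> borel_measurable lborel" .
    qed
    then show "(LINT t|lborel. h2 (s, t)) = indicat_real {0..T} s *\<^sub>R (f s * G s)"
      by (auto simp: G f'_def set_lebesgue_integral_def indicator_def)
  qed
  finally show ?thesis
    by (simp add: set_lebesgue_integral_def)
qed

lemma interval_integral_exp:
  fixes c :: real
  assumes "c \<noteq> 0" "0 \<le> t"
  shows "(LINT s:{0..t}|lborel. exp (c * s)) = (exp (c * t) - 1) / c"
proof -
  have "(\<integral>s. indicator {0..t} s *\<^sub>R exp (c * s) \<partial>lborel) = exp (c * t) / c - exp (c * 0) / c"
    by (rule integral_FTC_Icc) (use assms in \<open>auto intro!: derivative_eq_intros continuous_intros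
        simp flip: has_real_derivative_iff_has_vector_derivative\<close>)
  then show ?thesis
    by (simp add: set_lebesgue_integral_def diff_divide_distrib)
qed

text \<open>The solution of $x' = w - c x$, $x(0) = 0$ satisfies $(x^2)' = 2 x (w - c x)$ also when $w$ is merely
  integrable. In terms of $W(t) = e^{ct} x(t) = \int_0^t e^{cs} w(s)\,ds$ the claim is the product rule for
  $W \cdot W \cdot e^{-2ct}$, so integration by parts is used twice.\<close>

lemma square_of_convolution:
  fixes w x :: "real \<Rightarrow> real"
  assumes w: "set_integrable lborel {0..T} w"
    and x: "\<And>t. 0 \<le> t \<Longrightarrow> t \<le> T \<Longrightarrow> x t = (LINT s:{0..t}|lborel. exp (- c * (t - s)) * w s)"
    and cont: "continuous_on {0..T} x" and "c > 0" and T: "0 \<le> T"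
  shows "(LINT t:{0..T}|lborel. 2 * x t * (w t - c * x t)) = (x T)\<^sup>2"
proof -
  define W where "W = (\<lambda>t. exp (c * t) * x t)"
  define g where "g = (\<lambda>s. exp (c * s) * w s)"
  have contW: "continuous_on {0..T} W"
    unfolding W_def by (intro continuous_intros cont)
  have g: "set_integrable lborel {0..T} g"
    unfolding g_def by (intro set_integrable_continuous_mult w continuous_intros)
  have W: "W t = (LINT s:{0..t}|lborel. g s)" if "0 \<le> t" "t \<le> T" for t
  proof -
    have "(LINT s:{0..t}|lborel. g s) =
        (LINT s:{0..t}|lborel. exp (c * t) * (exp (- c * (t - s)) * w s))"
      unfolding g_def by (simp add: algebra_simps flip: exp_add)
    then show ?thesis
      by (simp add: W_def x[OF that])
  qed
  have Wg: "set_integrable lborel {0..T} (\<lambda>t. 2 * W t * g t)"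
    by (intro set_integrable_continuous_mult g continuous_intros contW)
  have W2: "(W t)\<^sup>2 = (LINT s:{0..t}|lborel. 2 * W s * g s)" if t: "0 \<le> t" "t \<le> T" for t
  proof -
    have gt: "set_integrable lborel {0..t} g"
      by (rule set_integrable_subset[OF g]) (use t in auto)
    have "W t * W t = (LINT s:{0..t}|lborel. W s * g s) + (LINT s:{0..t}|lborel. g s * W s)"
      by (rule product_of_integrals[OF gt gt]) (use t W in auto)
    moreover have "(LINT s:{0..t}|lborel. 2 * W s * g s) = 2 * (LINT s:{0..t}|lborel. W s * g s)"
      by (simp add: mult.assoc)
    ultimately show ?thesis
      by (simp add: power2_eq_square mult.commute)
  qed
  \<comment> \<open>The second factor has to vanish at 0, which is why 1 is subtracted from the exponential.\<close>
  have E: "set_integrable lborel {0..T} (\<lambda>s. - 2 * c * exp (- 2 * c * s))"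
    by (intro borel_integrable_atLeastAtMost' continuous_intros)
  have EI: "exp (- 2 * c * t) - 1 = (LINT s:{0..t}|lborel. - 2 * c * exp (- 2 * c * s))"
    if "0 \<le> t" for t
    unfolding set_integral_mult_right
    using interval_integral_exp[of "-2*c" t] that \<open>c > 0\<close> by simp
  have "(W T)\<^sup>2 * (exp (- 2 * c * T) - 1) =
      (LINT t:{0..T}|lborel. (W t)\<^sup>2 * (- 2 * c * exp (- 2 * c * t))) +
      (LINT t:{0..T}|lborel. 2 * W t * g t * (exp (- 2 * c * t) - 1))"
    by (rule product_of_integrals[OF Wg E]) (use T W2 EI in auto)
  then have "(W T)\<^sup>2 * exp (- 2 * c * T) =
      (LINT t:{0..T}|lborel. (W t)\<^sup>2 * (- 2 * c * exp (- 2 * c * t))) +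
      (LINT t:{0..T}|lborel. (exp (- 2 * c * t) - 1) * (2 * W t * g t)) +
      (LINT t:{0..T}|lborel. 2 * W t * g t)"
    using W2[of T] T by (simp add: algebra_simps)
  also have "\<dots> = (LINT t:{0..T}|lborel. (W t)\<^sup>2 * (- 2 * c * exp (- 2 * c * t)) +
      (exp (- 2 * c * t) - 1) * (2 * W t * g t) + 2 * W t * g t)"
  proof -
    have i1: "set_integrable lborel {0..T} (\<lambda>t. (W t)\<^sup>2 * (- 2 * c * exp (- 2 * c * t)))"
      by (intro borel_integrable_atLeastAtMost' continuous_intros contW)
    have i2: "set_integrable lborel {0..T} (\<lambda>t. (exp (- 2 * c * t) - 1) * (2 * W t * g t))"
      by (intro set_integrable_continuous_mult[OF _ Wg] continuous_intros)
    show ?thesis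
      using i1 i2 Wg by (simp only: set_integral_add)
  qed
  also have "\<dots> = (LINT t:{0..T}|lborel. 2 * x t * (w t - c * x t))"
  proof (rule set_lebesgue_integral_cong)
    show "\<forall>t. t \<in> {0..T} \<longrightarrow> (W t)\<^sup>2 * (- 2 * c * exp (- 2 * c * t)) +
      (exp (- 2 * c * t) - 1) * (2 * W t * g t) + 2 * W t * g t = 2 * x t * (w t - c * x t)"
    proof (intro allI impI)
      fix t
      have "exp (c * t) * exp (c * t) * exp (- 2 * c * t) = 1"
        by (simp flip: exp_add)
      then show "(W t)\<^sup>2 * (- 2 * c * exp (- 2 * c * t)) +
        (exp (- 2 * c * t) - 1) * (2 * W t * g t) + 2 * W t * g t = 2 * x t * (w t - c * x t)"
        unfolding W_def g_def power2_eq_square by algebra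
    qed
  qed auto
  finally have "(W T)\<^sup>2 * exp (- 2 * c * T) = (LINT t:{0..T}|lborel. 2 * x t * (w t - c * x t))" .
  moreover have "exp (c * T) * exp (c * T) * exp (- 2 * c * T) = 1"
    by (simp flip: exp_add)
  then have "(W T)\<^sup>2 * exp (- 2 * c * T) = (x T)\<^sup>2"
    unfolding W_def power2_eq_square by algebra
  ultimately show ?thesis by simp
qed

text \<open>The least energy that a forcing needs to reach a given level at time $T$. This is the
  Cauchy--Schwarz inequality, with $\int_0^T e^{-2c(T-s)}ds = (1 - e^{-2cT})/(2c)$.\<close>

lemma convolution_square_le:
  fixes w :: "real \<Rightarrow> real"
  assumes w: "set_integrable lborel {0..T} w"
    and w2: "set_integrable lborel {0..T} (\<lambda>s. (w s)\<^sup>2)"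
    and "c > 0" "T > 0"
  shows "c / (1 - exp (- 2 * c * T)) * (LINT s:{0..T}|lborel. exp (- c * (T - s)) * w s)\<^sup>2
      \<le> (LINT s:{0..T}|lborel. (w s)\<^sup>2) / 2"
proof -
  define K where "K = (1 - exp (- 2 * c * T)) / (2 * c)"
  define z where "z = (LINT s:{0..T}|lborel. exp (- c * (T - s)) * w s)"
  have K: "K > 0"
    using assms by (simp add: K_def)
  have KI: "(LINT s:{0..T}|lborel. (exp (- c * (T - s)))\<^sup>2) = K"
  proof -
    have "(LINT s:{0..T}|lborel. (exp (- c * (T - s)))\<^sup>2) =
        (LINT s:{0..T}|lborel. exp (- 2 * c * T) * exp (2 * c * s))"
      by (simp add: power2_eq_square algebra_simps flip: exp_add)
    also have "\<dots> = exp (- 2 * c * T) * ((exp (2 * c * T) - 1) / (2 * c))"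
      using interval_integral_exp[of "2 * c" T] assms by simp
    also have "\<dots> = K"
      unfolding K_def by (simp add: algebra_simps exp_minus field_simps)
    finally show ?thesis .
  qed
  have i: "set_integrable lborel {0..T} (\<lambda>s. exp (- c * (T - s)) * w s)"
    by (intro set_integrable_continuous_mult w continuous_intros)
  have e: "set_integrable lborel {0..T} (\<lambda>s. (exp (- c * (T - s)))\<^sup>2)"
    by (intro borel_integrable_atLeastAtMost' continuous_intros)
  \<comment> \<open>Subtracting from \<open>w\<close> its projection onto the kernel proves Cauchy--Schwarz.\<close>
  have "0 \<le> (LINT s:{0..T}|lborel. (w s - (z / K) * exp (- c * (T - s)))\<^sup>2)"
    unfolding set_lebesgue_integral_def by (intro integral_nonneg_AE AE_I2) auto
  also have "\<dots> = (LINT s:{0..T}|lborel. (w s)\<^sup>2 -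
      2 * (z / K) * (exp (- c * (T - s)) * w s) + (z / K)\<^sup>2 * (exp (- c * (T - s)))\<^sup>2)"
    by (intro set_lebesgue_integral_cong) (auto simp: power2_eq_square algebra_simps)
  also have "\<dots> = (LINT s:{0..T}|lborel. (w s)\<^sup>2) - 2 * (z / K) * z + (z / K)\<^sup>2 * K"
    using w2 i e
    by (simp only: set_integral_add set_integral_diff set_integrable_mult_right
        set_integral_mult_right KI z_def[symmetric])
  also have "\<dots> = (LINT s:{0..T}|lborel. (w s)\<^sup>2) - z\<^sup>2 / K"
    using K by (simp add: power2_eq_square field_simps)
  finally have "z\<^sup>2 / K \<le> (LINT s:{0..T}|lborel. (w s)\<^sup>2)" by simp
  then show ?thesis
    using \<open>c > 0\<close> unfolding K_def z_def by (simp add: field_simps)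
qed

text \<open>By Lebesgue differentiation, almost every value of an integrable function is the limit of its
  averages over shrinking intervals, and here these averages vanish.\<close>

lemma integral_zero_imp_AE_zero:
  fixes h :: "real \<Rightarrow> real"
  assumes h: "set_integrable lborel {0..T} h"
    and zero: "\<And>t. 0 \<le> t \<Longrightarrow> t \<le> T \<Longrightarrow> (LINT s:{0..t}|lborel. h s) = 0"
  shows "AE s in lborel. s \<in> {0..T} \<longrightarrow> h s = 0"
proof -
  define f where "f = (\<lambda>s. indicat_real {0..T} s *\<^sub>R h s)"
  have f: "integrable lborel f"
    using h unfolding f_def set_integrable_def .
  have fs: "set_integrable lborel A f" if "A \<in> sets lborel" for A
    using f that set_integrable_subset[of lborel UNIV f A] by (simp add: set_integrable_def)
  have pre: "(LINT s:{..t}|lborel. f s) = 0" for t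
  proof (cases "0 \<le> t")
    case True
    have "(LINT s:{..t}|lborel. f s) = (LINT s:{0..min t T}|lborel. h s)"
      unfolding set_lebesgue_integral_def f_def
      by (rule Bochner_Integration.integral_cong) (auto simp: indicator_def)
    also have "\<dots> = 0"
      using True zero[of "min t T"] by (cases "0 \<le> T") (auto simp: set_lebesgue_integral_def)
    finally show ?thesis .
  next
    case False
    then have "(LINT s:{..t}|lborel. f s) = (LINT s:{..t}|lborel. 0)"
      unfolding set_lebesgue_integral_def f_def
      by (intro Bochner_Integration.integral_cong) (auto simp: indicator_def)
    then show ?thesis by simp
  qed
  have box: "(LINT s:{a..b}|lborel. f s) = 0" if "a \<le> b" for a b
  proof -
    have "(LINT s:{..b}|lborel. f s) = (LINT s:{..a} \<union> {a..b}|lborel. f s)"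
      using that by (intro arg_cong2[where f = "\<lambda>A g. set_lebesgue_integral lborel A g"]) auto
    also have "\<dots> = (LINT s:{..a}|lborel. f s) + (LINT s:{a..b}|lborel. f s)"
    proof (rule set_integral_Un_AE)
      show "AE x in lborel. \<not> (x \<in> {..a} \<and> x \<in> {a..b})"
        using AE_lborel_singleton[of a] by eventually_elim auto
    qed (auto intro: fs)
    finally show ?thesis by (simp add: pre)
  qed
  have "f integrable_on cbox a b" for a b
    using set_borel_integral_eq_integral(1)[OF fs, of "cbox a b"] by simp
  then obtain N where N: "negligible N" and
    lim: "\<And>x e. x \<notin> N \<Longrightarrow> 0 < e \<Longrightarrow> \<exists>d>0. \<forall>k. 0 < k \<and> k < d \<longrightarrow>
        norm (integral (cbox x (x + k *\<^sub>R One)) f /\<^sub>R k ^ DIM(real) - f x) < e"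
    using integrable_ccontinuous_explicit by metis
  have f0: "f x = 0" if "x \<notin> N" for x
  proof (rule ccontr)
    assume "f x \<noteq> 0"
    then obtain d where d: "d > 0" "\<And>k. 0 < k \<Longrightarrow> k < d \<Longrightarrow>
        norm (integral (cbox x (x + k *\<^sub>R One)) f /\<^sub>R k ^ DIM(real) - f x) < \<bar>f x\<bar>"
      using lim[OF \<open>x \<notin> N\<close>, of "\<bar>f x\<bar>"] by (metis zero_less_abs_iff)
    have "integral {x..x + d / 2} f = 0"
      using set_borel_integral_eq_integral(2)[OF fs, of "{x..x + d / 2}"] box[of x "x + d / 2"] d
      by simp
    then show False
      using d(2)[of "d / 2"] d(1) by simp
  qed
  have "N \<in> null_sets lebesgue"
    using N by (simp add: negligible_iff_null_sets)
  then have "AE s in lebesgue. s \<notin> N"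
    by (rule AE_not_in)
  then have "AE s in lborel. s \<notin> N"
    by (simp add: AE_completion_iff)
  then show ?thesis
    by eventually_elim (use f0 in \<open>auto simp: f_def indicator_def split: if_splits\<close>)
qed

section \<open>Comparison of the cost coefficients\<close>

text \<open>Convexity of the exponential function: $-x$ is a convex combination of $0$ and $-cx$.\<close>

lemma one_minus_exp_le:
  fixes x c :: real
  assumes "c \<ge> 1"
  shows "1 - exp (- (c * x)) \<le> c * (1 - exp (- x))"
proof -
  have "exp ((1 - 1 / c) *\<^sub>R 0 + (1 / c) *\<^sub>R (- (c * x))) \<le>
      (1 - 1 / c) * exp 0 + (1 / c) * exp (- (c * x))"
    using assms by (intro convex_onD[OF exp_convex]) auto
  then have "exp (- x) \<le> 1 - 1 / c + 1 / c * exp (- (c * x))"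
    using assms by simp
  then have "c * exp (- x) \<le> c * (1 - 1 / c + 1 / c * exp (- (c * x)))"
    using assms by (intro mult_left_mono) auto
  then show ?thesis
    using assms by (simp add: algebra_simps)
qed

text \<open>This is where the gap between the eigenvalues enters. As $b \mapsto b/(1-e^{-2bt})$ is increasing, it
  suffices to take $b = 3a$; with $q = e^{-2at}$ the claim then becomes
  $3 - (2-q)(1+q+q^2) = (1-q)(1-q^2) \ge 0$. Without an additive $a$ on the left, $b \ge a$ would do:
  the factor 3 pays for the boundary term that the feedback produces in the first mode.\<close>

lemma mode_coefficient_ge:
  fixes a b t :: real
  assumes a: "a > 0" and b: "b \<ge> 3 * a" and t: "t > 0"
  shows "a / (1 - exp (- 2 * a * t)) + a \<le> b / (1 - exp (- 2 * b * t))"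
proof -
  define q where "q = exp (- 2 * a * t)"
  have q: "0 < q" "q < 1"
    using a t by (auto simp: q_def)
  have q3: "exp (- 2 * (3 * a) * t) = q ^ 3"
    unfolding q_def by (simp flip: exp_of_nat_mult)
  have pos: "0 < 1 - q ^ 3" "0 < 1 - exp (- 2 * b * t)"
    using q a b t by (auto simp: power_less_one_iff)
  have "0 \<le> (1 - q) * (1 - q) * (1 + q)"
    using q by (intro mult_nonneg_nonneg) auto
  then have "(1 + (1 - q)) * (1 - q ^ 3) \<le> 3 * (1 - q)"
    using mult_nonneg_nonneg[of "1 - q" "(1 - q) * (1 - q) * (1 + q)"] q
    by (auto simp: power3_eq_cube algebra_simps)
  then have "1 / (1 - q) + 1 \<le> 3 / (1 - q ^ 3)"
    using q pos by (simp add: field_simps)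
  then have "a / (1 - q) + a \<le> 3 * a / (1 - q ^ 3)"
    using mult_left_mono[of "1 / (1 - q) + 1" "3 / (1 - q ^ 3)" a] a by (simp add: algebra_simps)
  also have "\<dots> \<le> b / (1 - exp (- 2 * b * t))"
  proof -
    have "1 - exp (- (b / (3 * a) * (2 * (3 * a) * t))) \<le> b / (3 * a) * (1 - exp (- (2 * (3 * a) * t)))"
      using a b by (intro one_minus_exp_le) (simp add: field_simps)
    then have "1 - exp (- 2 * b * t) \<le> b / (3 * a) * (1 - q ^ 3)"
      using a q3 by (simp add: field_simps)
    then show ?thesis
      using pos a by (simp add: field_simps)
  qed
  finally show ?thesis
    by (simp add: q_def)
qed

section \<open>Expansion in an orthonormal basis\<close>

context
  fixes e :: "nat \<Rightarrow> 'a::real_inner"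
  assumes basis: "complete_orthonormal_basis e"
begin

lemma basis_inner: "j \<ge> 1 \<Longrightarrow> k \<ge> 1 \<Longrightarrow> e j \<bullet> e k = (if j = k then 1 else 0)"
  using basis unfolding complete_orthonormal_basis_def by blast

lemma basis_partial_sum_inner:
  assumes "k \<ge> 1" "k \<le> n"
  shows "(\<Sum>j=1..n. c j *\<^sub>R e j) \<bullet> e k = c k"
proof -
  have "(\<Sum>j=1..n. c j *\<^sub>R e j) \<bullet> e k = (\<Sum>j=1..n. if j = k then c j else 0)"
    unfolding inner_sum_left using assms by (intro sum.cong) (auto simp: basis_inner)
  then show ?thesis
    using assms by simp
qed

lemma basis_partial_sum_norm:
  "(norm (\<Sum>k=1..n. (x \<bullet> e k) *\<^sub>R e k))\<^sup>2 = (\<Sum>k=1..n. (x \<bullet> e k)\<^sup>2)"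
proof -
  let ?P = "\<Sum>k=1..n. (x \<bullet> e k) *\<^sub>R e k"
  have "(norm ?P)\<^sup>2 = (\<Sum>k=1..n. (x \<bullet> e k) * (?P \<bullet> e k))"
    unfolding power2_norm_eq_inner inner_sum_right[of ?P] by simp
  also have "\<dots> = (\<Sum>k=1..n. (x \<bullet> e k) * (x \<bullet> e k))"
    using basis_partial_sum_inner by (intro sum.cong) auto
  finally show ?thesis
    by (simp add: power2_eq_square)
qed

lemma basis_partial_sum_norm_le: "norm (\<Sum>k=1..n. (x \<bullet> e k) *\<^sub>R e k) \<le> norm x"
proof -
  let ?P = "\<Sum>k=1..n. (x \<bullet> e k) *\<^sub>R e k"
  have "x \<bullet> ?P = (\<Sum>k=1..n. (x \<bullet> e k)\<^sup>2)"
    by (simp add: inner_sum_right power2_eq_square)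
  then have "norm ?P * norm ?P \<le> norm x * norm ?P"
    using basis_partial_sum_norm[of x n] norm_cauchy_schwarz[of x ?P]
    by (simp add: power2_eq_square)
  then show ?thesis
    using norm_ge_zero[of x] by (cases "?P = 0") auto
qed

text \<open>Every vector of the span is eventually reproduced exactly, and the partial sums are contractions, so
  that convergence extends from the dense span to the whole space.\<close>

lemma basis_expansion: "(\<lambda>n. \<Sum>k=1..n. (x \<bullet> e k) *\<^sub>R e k) \<longlonglongrightarrow> x"
proof -
  define P where "P n x = (\<Sum>k=1..n. (x \<bullet> e k) *\<^sub>R e k)" for n x
  have P_diff: "P n (x - y) = P n x - P n y" for n x y
    by (simp add: P_def inner_diff_left scaleR_diff_left sum_subtractf)
  have fixed: "\<forall>\<^sub>F n in sequentially. P n p = p" if "p \<in> span (e ` {1..})" for p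
    using that
  proof (induction rule: span_induct)
    show "subspace {p. \<forall>\<^sub>F n in sequentially. P n p = p}"
    proof (intro subspaceI CollectI; (elim CollectE)?)
      show "\<forall>\<^sub>F n in sequentially. P n 0 = 0"
        by (simp add: P_def)
    next
      fix p q
      assume "\<forall>\<^sub>F n in sequentially. P n p = p" "\<forall>\<^sub>F n in sequentially. P n q = q"
      then show "\<forall>\<^sub>F n in sequentially. P n (p + q) = p + q"
        by eventually_elim (auto simp: P_def inner_add_left scaleR_add_left sum.distrib)
    next
      fix c p
      assume "\<forall>\<^sub>F n in sequentially. P n p = p"
      then show "\<forall>\<^sub>F n in sequentially. P n (c *\<^sub>R p) = c *\<^sub>R p"
      proof eventually_elim
        case (elim n)
        have "P n (c *\<^sub>R p) = c *\<^sub>R P n p"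
          by (simp add: P_def scaleR_sum_right)
        then show ?case by (simp add: elim)
      qed
    qed
  next
    fix p assume "p \<in> e ` {1..}"
    then obtain j where j: "p = e j" "j \<ge> 1" by auto
    show "\<forall>\<^sub>F n in sequentially. P n p = p"
      using eventually_ge_at_top[of j]
    proof eventually_elim
      case (elim n)
      have "P n p = (\<Sum>k=1..n. if k = j then e j else 0)"
        unfolding P_def j using j by (intro sum.cong) (auto simp: basis_inner)
      then show ?case
        using j elim by simp
    qed
  qed
  have "(\<lambda>n. P n x) \<longlonglongrightarrow> x"
  proof (rule metric_LIMSEQ_I)
    fix r :: real assume r: "r > 0"
    have "x \<in> closure (span (e ` {1..}))"
      using basis by (simp add: complete_orthonormal_basis_def)
    then obtain p where p: "p \<in> span (e ` {1..})" "dist p x < r / 2"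
      unfolding closure_approachable using r half_gt_zero by blast
    obtain N where N: "\<And>n. n \<ge> N \<Longrightarrow> P n p = p"
      using fixed[OF p(1)] by (auto simp: eventually_sequentially)
    show "\<exists>N. \<forall>n\<ge>N. dist (P n x) x < r"
    proof (intro exI allI impI)
      fix n assume "n \<ge> N"
      then have "P n x - x = P n (x - p) - (x - p)"
        by (simp add: P_diff N)
      also have "norm \<dots> \<le> norm (P n (x - p)) + norm (x - p)"
        by (rule norm_triangle_ineq4)
      also have "\<dots> \<le> 2 * norm (x - p)"
        using basis_partial_sum_norm_le[of "x - p" n] by (simp add: P_def)
      also have "\<dots> < r"
        using p(2) by (simp add: dist_norm norm_minus_commute)
      finally show "dist (P n x) x < r"
        by (simp add: dist_norm)
    qed
  qed
  then show ?thesis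
    by (simp add: P_def)
qed

lemma parseval: "(\<lambda>n. \<Sum>k=1..n. (x \<bullet> e k)\<^sup>2) \<longlonglongrightarrow> (norm x)\<^sup>2"
proof -
  have "(\<lambda>n. (norm (\<Sum>k=1..n. (x \<bullet> e k) *\<^sub>R e k))\<^sup>2) \<longlonglongrightarrow> (norm x)\<^sup>2"
    by (intro tendsto_intros basis_expansion)
  then show ?thesis
    unfolding basis_partial_sum_norm .
qed

lemma bessel: "(\<Sum>k=1..n. (x \<bullet> e k)\<^sup>2) \<le> (norm x)\<^sup>2"
  using basis_partial_sum_norm_le[of x n] unfolding basis_partial_sum_norm[symmetric]
  by (rule power_mono) simp

text \<open>A bounded operator is determined by its action on the basis, so all operators below can be computed
  coordinate by coordinate.\<close>

lemma diagonal_inner: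
  assumes F: "bounded_linear F" and diag: "\<And>k. k \<ge> 1 \<Longrightarrow> F (e k) = \<mu> k *\<^sub>R e k" and k: "k \<ge> 1"
  shows "F x \<bullet> e k = \<mu> k * (x \<bullet> e k)"
proof -
  interpret F: bounded_linear F by (rule F)
  have "(\<lambda>n. F (\<Sum>j=1..n. (x \<bullet> e j) *\<^sub>R e j) \<bullet> e k) \<longlonglongrightarrow> F x \<bullet> e k"
    by (intro tendsto_intros F.tendsto basis_expansion)
  moreover have "\<forall>\<^sub>F n in sequentially. F (\<Sum>j=1..n. (x \<bullet> e j) *\<^sub>R e j) \<bullet> e k = \<mu> k * (x \<bullet> e k)"
    using eventually_ge_at_top[of k]
  proof eventually_elim
    case (elim n)
    have "F (\<Sum>j=1..n. (x \<bullet> e j) *\<^sub>R e j) = (\<Sum>j=1..n. ((x \<bullet> e j) * \<mu> j) *\<^sub>R e j)"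
      unfolding F.sum by (intro sum.cong) (auto simp: F.scaleR diag)
    then show ?case
      using basis_partial_sum_inner[OF k elim] by simp
  qed
  ultimately have "(\<lambda>n. \<mu> k * (x \<bullet> e k)) \<longlonglongrightarrow> F x \<bullet> e k"
    using Lim_transform_eventually by fastforce
  then show ?thesis
    using LIMSEQ_unique tendsto_const by blast
qed

end

section \<open>Modes of the mild solution\<close>

locale diagonal_system =
  fixes e :: "nat \<Rightarrow> 'a::{real_inner, banach, second_countable_topology}"
    and S :: "real \<Rightarrow> 'a \<Rightarrow> 'a" and B :: "'a \<Rightarrow> 'a" and \<alpha> lam :: "nat \<Rightarrow> real"
  assumes basis: "complete_orthonormal_basis e"
    and alpha_pos: "k \<ge> 1 \<Longrightarrow> 0 < \<alpha> k"
    and lam_pos: "k \<ge> 1 \<Longrightarrow> 0 < lam k"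
    and S_linear: "t \<ge> 0 \<Longrightarrow> bounded_linear (S t)"
    and S_basis: "k \<ge> 1 \<Longrightarrow> t \<ge> 0 \<Longrightarrow> S t (e k) = exp (- \<alpha> k * t) *\<^sub>R e k"
    and B_linear: "bounded_linear B"
    and B_basis: "k \<ge> 1 \<Longrightarrow> B (e k) = lam k *\<^sub>R e k"
begin

lemma S_inner: "t \<ge> 0 \<Longrightarrow> k \<ge> 1 \<Longrightarrow> S t x \<bullet> e k = exp (- \<alpha> k * t) * (x \<bullet> e k)"
  by (rule diagonal_inner[OF basis S_linear]) (auto simp: S_basis)

lemma B_inner: "k \<ge> 1 \<Longrightarrow> B x \<bullet> e k = lam k * (x \<bullet> e k)"
  by (rule diagonal_inner[OF basis B_linear]) (auto simp: B_basis)

lemma S_contraction: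
  assumes "t \<ge> 0"
  shows "norm (S t x) \<le> norm x"
proof -
  have "(norm (S t x))\<^sup>2 \<le> (norm x)\<^sup>2"
  proof (rule LIMSEQ_le[OF parseval[OF basis] parseval[OF basis]], intro exI[of _ 0] allI impI sum_mono)
    fix n k :: nat assume "k \<in> {1..n}"
    then have k: "k \<ge> 1" by simp
    have "\<bar>S t x \<bullet> e k\<bar> \<le> \<bar>x \<bullet> e k\<bar>"
      using alpha_pos[OF k] assms by (simp add: S_inner[OF assms k] abs_mult mult_left_le_one_le)
    then show "(S t x \<bullet> e k)\<^sup>2 \<le> (x \<bullet> e k)\<^sup>2"
      by (simp add: abs_le_square_iff)
  qed
  then show ?thesis
    by (rule power2_le_imp_le) simp
qed

text \<open>Integrability of the convolution integrand is needed before coordinates may be taken under the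
  integral. Measurability in $s$, where both the operator and its argument vary, follows from the basis
  expansion: each coordinate is a product of measurable scalar functions.\<close>

lemma set_integrable_duhamel:
  assumes f: "set_integrable lborel {0..t} f"
  shows "set_integrable lborel {0..t} (\<lambda>s. S (t - s) (B (f s)))"
proof -
  define f' where "f' = (\<lambda>s. indicat_real {0..t} s *\<^sub>R f s)"
  have [measurable]: "f' \<in> borel_measurable lborel"
    using f unfolding f'_def set_integrable_def by (rule borel_measurable_integrable)
  obtain K where K: "\<And>x. norm (B x) \<le> norm x * K"
    using bounded_linear.bounded[OF B_linear] by auto
  show ?thesis
    unfolding set_integrable_def
  proof (rule Bochner_Integration.integrable_bound)
    show "integrable lborel (\<lambda>s. K * norm (f' s))"
      using f unfolding f'_def set_integrable_def
      by (intro integrable_mult_right integrable_norm)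
    show "(\<lambda>s. indicat_real {0..t} s *\<^sub>R S (t - s) (B (f s))) \<in> borel_measurable lborel"
    proof (rule borel_measurable_LIMSEQ_metric)
      fix n
      show "(\<lambda>s. \<Sum>k=1..n. (indicat_real {0..t} s * exp (- \<alpha> k * (t - s)) * lam k * (f' s \<bullet> e k)) *\<^sub>R e k)
          \<in> borel_measurable lborel"
        by measurable
    next
      fix s
      let ?g = "indicat_real {0..t} s *\<^sub>R S (t - s) (B (f s))"
      have "(\<Sum>k=1..n. (?g \<bullet> e k) *\<^sub>R e k) =
          (\<Sum>k=1..n. (indicat_real {0..t} s * exp (- \<alpha> k * (t - s)) * lam k * (f' s \<bullet> e k)) *\<^sub>R e k)" for n
        by (intro sum.cong) (auto simp: f'_def indicator_def S_inner B_inner)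
      then show "(\<lambda>n. \<Sum>k=1..n. (indicat_real {0..t} s * exp (- \<alpha> k * (t - s)) * lam k * (f' s \<bullet> e k)) *\<^sub>R e k)
          \<longlonglongrightarrow> ?g"
        using basis_expansion[OF basis, of ?g] by simp
    qed
    show "AE s in lborel. norm (indicat_real {0..t} s *\<^sub>R S (t - s) (B (f s))) \<le> norm (K * norm (f' s))"
    proof (rule AE_I2)
      fix s
      show "norm (indicat_real {0..t} s *\<^sub>R S (t - s) (B (f s))) \<le> norm (K * norm (f' s))"
      proof (cases "s \<in> {0..t}")
        case True
        then have "norm (S (t - s) (B (f s))) \<le> norm (f s) * K"
          using S_contraction[of "t - s" "B (f s)"] K[of "f s"] by simp
        also have "\<dots> \<le> norm (f s) * \<bar>K\<bar>"
          by (intro mult_left_mono) auto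
        finally show ?thesis
          using True by (simp add: f'_def abs_mult mult.commute)
      qed (simp add: f'_def)
    qed
  qed
qed

lemma duhamel_mode:
  assumes f: "set_integrable lborel {0..t} f" and k: "k \<ge> 1"
  shows "(LINT s:{0..t}|lborel. S (t - s) (B (f s))) \<bullet> e k =
    (LINT s:{0..t}|lborel. exp (- \<alpha> k * (t - s)) * (lam k * (f s \<bullet> e k)))"
proof -
  have "(LINT s:{0..t}|lborel. S (t - s) (B (f s))) \<bullet> e k =
      (LINT s|lborel. indicat_real {0..t} s *\<^sub>R S (t - s) (B (f s)) \<bullet> e k)"
    unfolding set_lebesgue_integral_def
    using set_integrable_duhamel[OF f] unfolding set_integrable_def
    by (rule integral_inner_left[symmetric])
  also have "\<dots> = (LINT s:{0..t}|lborel. exp (- \<alpha> k * (t - s)) * (lam k * (f s \<bullet> e k)))"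
    unfolding set_lebesgue_integral_def
  proof (rule Bochner_Integration.integral_cong[OF refl])
    fix s
    show "indicat_real {0..t} s *\<^sub>R S (t - s) (B (f s)) \<bullet> e k =
        indicat_real {0..t} s *\<^sub>R (exp (- \<alpha> k * (t - s)) * (lam k * (f s \<bullet> e k)))"
      by (cases "s \<in> {0..t}") (simp_all add: S_inner[OF _ k] B_inner[OF k] del: One_nat_def)
  qed
  finally show ?thesis .
qed

end

lemma set_integrable_inner:
  fixes f :: "'a \<Rightarrow> 'b::{real_inner, banach, second_countable_topology}"
  assumes "set_integrable M A f"
  shows "set_integrable M A (\<lambda>s. f s \<bullet> c)"
proof -
  have "integrable M (\<lambda>s. (indicat_real A s *\<^sub>R f s) \<bullet> c)"
    using assms unfolding set_integrable_def by (rule integrable_inner_left)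
  then show ?thesis
    unfolding set_integrable_def inner_scaleR_left real_scaleR_def .
qed

lemma L2_control_inner_square:
  fixes v :: "real \<Rightarrow> 'a::{real_inner, second_countable_topology}"
  assumes "L2_control T v"
  shows "set_integrable lborel {0..T} (\<lambda>s. (v s \<bullet> c)\<^sup>2)"
proof -
  define v' where "v' = (\<lambda>s. indicat_real {0..T} s *\<^sub>R v s)"
  have [measurable]: "v' \<in> borel_measurable lborel"
    using assms unfolding v'_def L2_control_def set_borel_measurable_def by auto
  have "(\<lambda>s. indicat_real {0..T} s *\<^sub>R (v s \<bullet> c)\<^sup>2) = (\<lambda>s. (v' s \<bullet> c)\<^sup>2)"
    by (auto simp: v'_def indicator_def)
  then have "set_borel_measurable lborel {0..T} (\<lambda>s. (v s \<bullet> c)\<^sup>2)"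
    unfolding set_borel_measurable_def by simp
  moreover have "set_integrable lborel {0..T} (\<lambda>s. (norm c)\<^sup>2 * (norm (v s))\<^sup>2)"
    using assms by (simp add: L2_control_def)
  moreover have "norm ((v s \<bullet> c)\<^sup>2) \<le> norm ((norm c)\<^sup>2 * (norm (v s))\<^sup>2)" for s
    using Cauchy_Schwarz_ineq[of "v s" c] by (simp add: power2_norm_eq_inner mult.commute)
  then have "AE s in lborel. s \<in> {0..T} \<longrightarrow>
      norm ((v s \<bullet> c)\<^sup>2) \<le> norm ((norm c)\<^sup>2 * (norm (v s))\<^sup>2)"
    by (intro AE_I2 impI)
  ultimately show ?thesis
    using set_integrable_bound by blast
qed

lemma L2_control_integrable:
  fixes v :: "real \<Rightarrow> 'a::{real_inner, banach, second_countable_topology}"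
  assumes "L2_control T v"
  shows "set_integrable lborel {0..T} v"
proof (rule set_integrable_bound)
  show "set_integrable lborel {0..T} (\<lambda>s. 1 + (norm (v s))\<^sup>2)"
    using set_integral_add(1)[OF borel_integrable_atLeastAtMost'[OF continuous_on_const]] assms
    unfolding L2_control_def by blast
  show "set_borel_measurable lborel {0..T} v"
    using assms by (simp add: L2_control_def)
  have "norm (v s) \<le> norm (1 + (norm (v s))\<^sup>2)" for s
  proof -
    have "0 \<le> (norm (v s) - 1)\<^sup>2" by simp
    then have "2 * norm (v s) \<le> 1 + (norm (v s))\<^sup>2"
      by (simp add: power2_eq_square algebra_simps)
    moreover have "0 \<le> norm (v s)" "norm (1 + (norm (v s))\<^sup>2) = 1 + (norm (v s))\<^sup>2"
      by simp_all
    ultimately show ?thesis by linarith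
  qed
  then show "AE s in lborel. s \<in> {0..T} \<longrightarrow> norm (v s) \<le> norm (1 + (norm (v s))\<^sup>2)"
    by simp
qed

section \<open>Exit time\<close>

text \<open>
  The times at which the path is not inside the open ball form a compact set that does not contain 0;
  its least element is the exit time.\<close>

lemma exit_time_attained:
  fixes y :: "real \<Rightarrow> 'a::real_normed_vector"
  assumes y: "y \<in> exit_paths T L" and L: "0 < L"
  obtains \<tau> where "0 < \<tau>" "\<tau> \<le> T" "L \<le> norm (y \<tau>)"
    "{s. 0 \<le> s \<and> s \<le> T \<and> ereal s \<le> exit_time T L y} = {0..\<tau>}"
proof -
  define Q where "Q = {t. 0 < t \<and> t \<le> T \<and> L \<le> norm (y t)}"
  have cont: "continuous_on {0..T} y" and y0: "y 0 = 0" and ex: "\<exists>t\<in>{0..T}. norm (y t) = L"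
    using y by (auto simp: exit_paths_def)
  have Q: "Q = {0..T} \<inter> (\<lambda>t. norm (y t)) -` {L..}"
    using y0 L by (auto simp: Q_def order_le_less)
  have "closed Q"
    unfolding Q by (intro continuous_closed_preimage continuous_on_norm cont) auto
  then have "compact Q"
    unfolding compact_eq_bounded_closed Q by (auto intro: bounded_subset[of "{0..T}"])
  moreover have "Q \<noteq> {}"
    using ex unfolding Q by auto
  ultimately obtain \<tau> where \<tau>: "\<tau> \<in> Q" "\<And>t. t \<in> Q \<Longrightarrow> \<tau> \<le> t"
    using compact_attains_inf[of Q] by metis
  have "exit_time T L y = ereal \<tau>"
    unfolding exit_time_def Q_def[symmetric]
    by (intro antisym INF_lower INF_greatest) (use \<tau> in auto)
  then have "{s. 0 \<le> s \<and> s \<le> T \<and> ereal s \<le> exit_time T L y} = {0..\<tau>}"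
    using \<tau>(1) by (auto simp: Q_def)
  then show thesis
    using that[of \<tau>] \<tau>(1) by (simp add: Q_def)
qed


section \<open>The cost of reaching a level\<close>

text \<open>The forcing of a mode is determined almost everywhere by the path of that mode.\<close>

lemma convolution_zero_imp_AE_zero:
  fixes h :: "real \<Rightarrow> real"
  assumes h: "set_integrable lborel {0..T} h"
    and zero: "\<And>t. 0 \<le> t \<Longrightarrow> t \<le> T \<Longrightarrow> (LINT s:{0..t}|lborel. exp (- c * (t - s)) * h s) = 0"
  shows "AE s in lborel. s \<in> {0..T} \<longrightarrow> h s = 0"
proof -
  have "AE s in lborel. s \<in> {0..T} \<longrightarrow> exp (c * s) * h s = 0"
  proof (rule integral_zero_imp_AE_zero)
    show "set_integrable lborel {0..T} (\<lambda>s. exp (c * s) * h s)"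
      by (intro set_integrable_continuous_mult h continuous_intros)
    fix t assume t: "0 \<le> t" "t \<le> T"
    have "(LINT s:{0..t}|lborel. exp (c * s) * h s) =
        (LINT s:{0..t}|lborel. exp (c * t) * (exp (- c * (t - s)) * h s))"
      by (simp add: algebra_simps flip: exp_add)
    also have "\<dots> = 0"
      unfolding set_integral_mult_right zero[OF t] by simp
    finally show "(LINT s:{0..t}|lborel. exp (c * s) * h s) = 0" .
  qed
  then show ?thesis by simp
qed

locale feedback_system = diagonal_system e S B \<alpha> lam
  for e :: "nat \<Rightarrow> 'a::{real_inner, banach, second_countable_topology}" and S B \<alpha> lam +
  fixes u :: "'a \<Rightarrow> 'a"
  assumes u_eq: "u = (\<lambda>x. (2 * \<alpha> 1 / lam 1 * (x \<bullet> e 1)) *\<^sub>R e 1)"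
    and gap: "k \<ge> 2 \<Longrightarrow> lam k \<le> lam 1 \<and> 3 * \<alpha> 1 < \<alpha> k"
begin

text \<open>
  The minimal cost of exiting at time $t$ is this rate times the squared radius of the ball.
\<close>

definition exit_rate :: "real \<Rightarrow> real" where
  "exit_rate t = (\<alpha> 1 / (1 - exp (- 2 * \<alpha> 1 * t)) + \<alpha> 1) / (lam 1)\<^sup>2"

lemma exit_rate_antimono:
  assumes "0 < s" "s \<le> t"
  shows "exit_rate t \<le> exit_rate s"
proof -
  have "0 < 1 - exp (- 2 * \<alpha> 1 * s)" "exp (- 2 * \<alpha> 1 * t) \<le> exp (- 2 * \<alpha> 1 * s)"
    using alpha_pos[of 1] assms by auto
  moreover from this have "0 < 1 - exp (- 2 * \<alpha> 1 * t)"
    by linarith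
  ultimately show ?thesis
    unfolding exit_rate_def using alpha_pos[of 1]
    by (intro divide_right_mono add_right_mono divide_left_mono mult_pos_pos) auto
qed

lemma exit_rate_nonneg: "0 < t \<Longrightarrow> 0 \<le> exit_rate t"
  using alpha_pos[of 1] unfolding exit_rate_def by (intro divide_nonneg_nonneg add_nonneg_nonneg) auto

lemma norm_e1: "norm (e 1) = 1"
  using basis_inner[OF basis, of 1 1] by (simp add: norm_eq_sqrt_inner)

lemma u_inner: "k \<ge> 1 \<Longrightarrow> u x \<bullet> e k = (if k = 1 then 2 * \<alpha> 1 / lam 1 * (x \<bullet> e 1) else 0)"
  unfolding u_eq by (simp add: basis_inner[OF basis])

lemma norm_u: "(norm (u x))\<^sup>2 = (2 * \<alpha> 1 / lam 1 * (x \<bullet> e 1))\<^sup>2"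
  unfolding u_eq norm_scaleR norm_e1 real_norm_def mult_1_right power2_abs ..

context
  fixes T :: real and v X :: "real \<Rightarrow> 'a"
  assumes control: "L2_control T v" and mild: "mild_solution T S B u v X"
begin

lemma continuous_mode: "continuous_on {0..T} (\<lambda>s. X s \<bullet> e k)"
  using mild unfolding mild_solution_def by (intro continuous_intros) auto

lemma integrable_forcing: "set_integrable lborel {0..T} (\<lambda>s. v s - u (X s))"
proof (rule set_integral_diff(1)[OF L2_control_integrable[OF control]])
  show "set_integrable lborel {0..T} (\<lambda>s. u (X s))"
    unfolding u_eq by (intro borel_integrable_atLeastAtMost' continuous_intros continuous_mode)
qed

lemma mild_mode:
  assumes "0 \<le> t" "t \<le> T" "k \<ge> 1"
  shows "X t \<bullet> e k = (LINT s:{0..t}|lborel. exp (- \<alpha> k * (t - s)) * (lam k * ((v s - u (X s)) \<bullet> e k)))"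
proof -
  have "X t = (LINT s:{0..t}|lborel. S (t - s) (B (v s - u (X s))))"
    using mild assms by (auto simp: mild_solution_def)
  moreover have "set_integrable lborel {0..t} (\<lambda>s. v s - u (X s))"
    by (rule set_integrable_subset[OF integrable_forcing]) (use assms in auto)
  ultimately show ?thesis
    using duhamel_mode assms(3) by simp
qed

lemma integrable_mode_forcing:
  "set_integrable lborel {0..T} (\<lambda>s. lam k * ((v s - u (X s)) \<bullet> e k))"
  by (intro set_integrable_mult_right set_integrable_inner integrable_forcing)

lemma integrable_feedback_cost: "set_integrable lborel {0..T} (\<lambda>s. (norm (u (X s)))\<^sup>2)"
  unfolding norm_u by (intro borel_integrable_atLeastAtMost' continuous_intros continuous_mode)

text \<open>After expanding the square, the mixed term is a continuous function times an integrable one.\<close>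

lemma integrable_first_forcing_square:
  "set_integrable lborel {0..T} (\<lambda>s. (lam 1 * ((v s - u (X s)) \<bullet> e 1))\<^sup>2)"
proof -
  have eq: "(lam 1 * ((v s - u (X s)) \<bullet> e 1))\<^sup>2 = (lam 1)\<^sup>2 * (v s \<bullet> e 1)\<^sup>2
      + ((2 * \<alpha> 1)\<^sup>2 * (X s \<bullet> e 1)\<^sup>2 - (4 * \<alpha> 1 * lam 1 * (X s \<bullet> e 1)) * (v s \<bullet> e 1))" for s
    using lam_pos[of 1] by (simp add: inner_diff_left u_inner power2_eq_square field_simps)
  have "set_integrable lborel {0..T} (\<lambda>s. (2 * \<alpha> 1)\<^sup>2 * (X s \<bullet> e 1)\<^sup>2)"
    by (intro borel_integrable_atLeastAtMost' continuous_intros continuous_mode)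
  moreover have "set_integrable lborel {0..T} (\<lambda>s. (4 * \<alpha> 1 * lam 1 * (X s \<bullet> e 1)) * (v s \<bullet> e 1))"
    by (intro set_integrable_continuous_mult continuous_intros continuous_mode
        set_integrable_inner L2_control_integrable control)
  moreover have "set_integrable lborel {0..T} (\<lambda>s. (lam 1)\<^sup>2 * (v s \<bullet> e 1)\<^sup>2)"
    by (intro set_integrable_mult_right L2_control_inner_square control)
  ultimately show ?thesis
    unfolding eq by (intro set_integral_add(1) set_integral_diff(1))
qed

context
  fixes \<tau> :: real
  assumes \<tau>: "0 < \<tau>" "\<tau> \<le> T"
begin

lemma set_integrable_until:
  fixes f :: "real \<Rightarrow> real"
  assumes "set_integrable lborel {0..T} f"
  shows "set_integrable lborel {0..\<tau>} f"
  by (rule set_integrable_subset[OF assms]) (use \<tau> in auto)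

text \<open>The feedback is chosen so that the quadratic form in the cost becomes, in terms of the
  forcing $w$, the sum of $w^2/2$ and the derivative of $\alpha_1 x^2$. Being an identity, this serves both the
  lower bound and the evaluation of the cost at the minimizer.\<close>

lemma first_mode_cost:
  "(lam 1)\<^sup>2 * (LINT s:{0..\<tau>}|lborel. (v s \<bullet> e 1)\<^sup>2 / 2 - (norm (u (X s)))\<^sup>2) =
    (LINT s:{0..\<tau>}|lborel. (lam 1 * ((v s - u (X s)) \<bullet> e 1))\<^sup>2) / 2 + \<alpha> 1 * (X \<tau> \<bullet> e 1)\<^sup>2"
proof -
  define w where "w = (\<lambda>s. lam 1 * ((v s - u (X s)) \<bullet> e 1))"
  define x where "x = (\<lambda>s. X s \<bullet> e 1)"
  have w: "set_integrable lborel {0..\<tau>} w"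
    unfolding w_def by (intro set_integrable_until integrable_mode_forcing)
  have w2: "set_integrable lborel {0..\<tau>} (\<lambda>s. (w s)\<^sup>2)"
    unfolding w_def by (intro set_integrable_until integrable_first_forcing_square)
  have contx: "continuous_on {0..\<tau>} x"
    unfolding x_def by (rule continuous_on_subset[OF continuous_mode]) (use \<tau> in auto)
  have xx: "set_integrable lborel {0..\<tau>} (\<lambda>t. 2 * x t * (w t - \<alpha> 1 * x t))"
    by (intro set_integrable_continuous_mult continuous_intros contx set_integral_diff(1) w
        borel_integrable_atLeastAtMost')
  have sq: "(LINT t:{0..\<tau>}|lborel. 2 * x t * (w t - \<alpha> 1 * x t)) = (x \<tau>)\<^sup>2"
    by (rule square_of_convolution[OF w _ contx alpha_pos])
      (use \<tau> mild_mode[of _ 1] in \<open>auto simp: x_def w_def\<close>)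
  have pw: "(lam 1)\<^sup>2 * ((v s \<bullet> e 1)\<^sup>2 / 2 - (norm (u (X s)))\<^sup>2) =
      1 / 2 * (w s)\<^sup>2 + \<alpha> 1 * (2 * x s * (w s - \<alpha> 1 * x s))" for s
  proof -
    have w_eq: "w s = lam 1 * (v s \<bullet> e 1) - 2 * \<alpha> 1 * x s"
      using lam_pos[of 1] by (simp add: w_def x_def inner_diff_left u_inner field_simps)
    have "(lam 1)\<^sup>2 * (norm (u (X s)))\<^sup>2 = (2 * \<alpha> 1 * x s)\<^sup>2"
      using lam_pos[of 1] unfolding norm_u x_def by (simp add: power2_eq_square field_simps)
    then show ?thesis
      unfolding w_eq by (simp add: power2_eq_square algebra_simps)
  qed
  have "(lam 1)\<^sup>2 * (LINT s:{0..\<tau>}|lborel. (v s \<bullet> e 1)\<^sup>2 / 2 - (norm (u (X s)))\<^sup>2) =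
      (LINT s:{0..\<tau>}|lborel. 1 / 2 * (w s)\<^sup>2 + \<alpha> 1 * (2 * x s * (w s - \<alpha> 1 * x s)))"
    unfolding set_integral_mult_right[symmetric] pw ..
  also have "\<dots> = (LINT s:{0..\<tau>}|lborel. 1 / 2 * (w s)\<^sup>2) +
      (LINT s:{0..\<tau>}|lborel. \<alpha> 1 * (2 * x s * (w s - \<alpha> 1 * x s)))"
    by (rule set_integral_add(2)) (intro set_integrable_mult_right w2 xx)+
  also have "\<dots> = 1 / 2 * (LINT s:{0..\<tau>}|lborel. (w s)\<^sup>2) + \<alpha> 1 * (x \<tau>)\<^sup>2"
    unfolding set_integral_mult_right sq ..
  finally show ?thesis
    by (simp add: w_def x_def)
qed

lemma first_mode_cost_ge:
  "exit_rate \<tau> * (X \<tau> \<bullet> e 1)\<^sup>2 \<le> (LINT s:{0..\<tau>}|lborel. (v s \<bullet> e 1)\<^sup>2 / 2 - (norm (u (X s)))\<^sup>2)"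
proof -
  have "\<alpha> 1 / (1 - exp (- 2 * \<alpha> 1 * \<tau>)) * (X \<tau> \<bullet> e 1)\<^sup>2 \<le>
      (LINT s:{0..\<tau>}|lborel. (lam 1 * ((v s - u (X s)) \<bullet> e 1))\<^sup>2) / 2"
    using convolution_square_le[OF set_integrable_until[OF integrable_mode_forcing]
        set_integrable_until[OF integrable_first_forcing_square] alpha_pos[of 1] \<tau>(1)] mild_mode[of \<tau> 1] \<tau>
    by simp
  moreover have "(lam 1)\<^sup>2 * (exit_rate \<tau> * (X \<tau> \<bullet> e 1)\<^sup>2) =
      \<alpha> 1 / (1 - exp (- 2 * \<alpha> 1 * \<tau>)) * (X \<tau> \<bullet> e 1)\<^sup>2 + \<alpha> 1 * (X \<tau> \<bullet> e 1)\<^sup>2"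
    using lam_pos[of 1] unfolding exit_rate_def by (simp add: distrib_right)
  ultimately have "(lam 1)\<^sup>2 * (exit_rate \<tau> * (X \<tau> \<bullet> e 1)\<^sup>2) \<le>
      (lam 1)\<^sup>2 * (LINT s:{0..\<tau>}|lborel. (v s \<bullet> e 1)\<^sup>2 / 2 - (norm (u (X s)))\<^sup>2)"
    unfolding first_mode_cost by linarith
  then show ?thesis
    using lam_pos[of 1] by simp
qed

text \<open>In these modes the forcing is $\lambda_k v_k$, since the feedback vanishes there, so the control energy is
  the forcing energy divided by $\lambda_k^2 \le \lambda_1^2$; the spectral gap then gives the rate of the
  first mode.\<close>

lemma higher_mode_cost_ge:
  assumes k: "k \<ge> 2"
  shows "exit_rate \<tau> * (X \<tau> \<bullet> e k)\<^sup>2 \<le> (LINT s:{0..\<tau>}|lborel. (v s \<bullet> e k)\<^sup>2 / 2)"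
proof -
  have k1: "k \<ge> 1" using k by simp
  have lam: "0 < lam k" "lam k \<le> lam 1" "0 < lam 1" and al: "0 < \<alpha> 1" "3 * \<alpha> 1 \<le> \<alpha> k" "0 < \<alpha> k"
    using lam_pos[of k] lam_pos[of 1] gap[OF k] alpha_pos[of 1] alpha_pos[of k] k by auto
  let ?V = "LINT s:{0..\<tau>}|lborel. (v s \<bullet> e k)\<^sup>2"
  have forcing: "lam k * ((v s - u (X s)) \<bullet> e k) = lam k * (v s \<bullet> e k)" for s
    using u_inner[OF k1] k by (simp add: inner_diff_left)
  have "set_integrable lborel {0..\<tau>} (\<lambda>s. lam k * (v s \<bullet> e k))"
    using set_integrable_until[OF integrable_mode_forcing, of k] unfolding forcing .
  moreover have "set_integrable lborel {0..\<tau>} (\<lambda>s. (lam k * (v s \<bullet> e k))\<^sup>2)"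
    unfolding power_mult_distrib
    by (intro set_integrable_until set_integrable_mult_right L2_control_inner_square control)
  ultimately have "\<alpha> k / (1 - exp (- 2 * \<alpha> k * \<tau>)) * (X \<tau> \<bullet> e k)\<^sup>2 \<le>
      (LINT s:{0..\<tau>}|lborel. (lam k * (v s \<bullet> e k))\<^sup>2) / 2"
    using convolution_square_le[OF _ _ al(3) \<tau>(1)] mild_mode[OF _ \<tau>(2) k1] \<tau>
    unfolding forcing by simp
  also have "\<dots> = (lam k)\<^sup>2 * (?V / 2)"
    unfolding power_mult_distrib set_integral_mult_right by simp
  also have "\<dots> \<le> (lam 1)\<^sup>2 * (?V / 2)"
  proof (intro mult_right_mono power_mono)
    show "0 \<le> ?V / 2"
      unfolding set_lebesgue_integral_def by (intro divide_nonneg_nonneg integral_nonneg_AE AE_I2) auto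
  qed (use lam in auto)
  finally have "\<alpha> k / (1 - exp (- 2 * \<alpha> k * \<tau>)) * (X \<tau> \<bullet> e k)\<^sup>2 \<le> (lam 1)\<^sup>2 * (?V / 2)" .
  moreover have "(\<alpha> 1 / (1 - exp (- 2 * \<alpha> 1 * \<tau>)) + \<alpha> 1) * (X \<tau> \<bullet> e k)\<^sup>2 \<le>
      \<alpha> k / (1 - exp (- 2 * \<alpha> k * \<tau>)) * (X \<tau> \<bullet> e k)\<^sup>2"
    by (intro mult_right_mono mode_coefficient_ge al \<tau>) auto
  ultimately have "(\<alpha> 1 / (1 - exp (- 2 * \<alpha> 1 * \<tau>)) + \<alpha> 1) * (X \<tau> \<bullet> e k)\<^sup>2 \<le> (?V / 2) * (lam 1)\<^sup>2"
    by (simp only: mult.commute)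
  then have "exit_rate \<tau> * (X \<tau> \<bullet> e k)\<^sup>2 \<le> ?V / 2"
    unfolding exit_rate_def using lam by (simp add: pos_divide_le_eq)
  then show ?thesis
    by simp
qed

text \<open>Only finitely many modes are summed here, so that no interchange of a series with the integral is
  needed; integrability is carried along to allow the integral to be split.\<close>

lemma finitely_many_modes_cost_ge:
  "set_integrable lborel {0..\<tau>} (\<lambda>s. (\<Sum>k=1..Suc n. (v s \<bullet> e k)\<^sup>2) / 2 - (norm (u (X s)))\<^sup>2) \<and>
   exit_rate \<tau> * (\<Sum>k=1..Suc n. (X \<tau> \<bullet> e k)\<^sup>2) \<le>
     (LINT s:{0..\<tau>}|lborel. (\<Sum>k=1..Suc n. (v s \<bullet> e k)\<^sup>2) / 2 - (norm (u (X s)))\<^sup>2)"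
proof (induction n)
  case 0
  have "set_integrable lborel {0..\<tau>} (\<lambda>s. (v s \<bullet> e 1)\<^sup>2 / 2 - (norm (u (X s)))\<^sup>2)"
    by (intro set_integral_diff(1) set_integrable_divide set_integrable_until L2_control_inner_square
        control integrable_feedback_cost)
  then show ?case
    using first_mode_cost_ge by simp
next
  case (Suc n)
  let ?k = "Suc (Suc n)"
  have split: "(\<Sum>k=1..?k. (v s \<bullet> e k)\<^sup>2) / 2 - (norm (u (X s)))\<^sup>2 =
      ((\<Sum>k=1..Suc n. (v s \<bullet> e k)\<^sup>2) / 2 - (norm (u (X s)))\<^sup>2) + (v s \<bullet> e ?k)\<^sup>2 / 2" for s
    by (simp add: add_divide_distrib)
  have i: "set_integrable lborel {0..\<tau>} (\<lambda>s. (v s \<bullet> e ?k)\<^sup>2 / 2)"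
    by (intro set_integrable_divide set_integrable_until L2_control_inner_square control)
  have "exit_rate \<tau> * (\<Sum>k=1..?k. (X \<tau> \<bullet> e k)\<^sup>2) =
      exit_rate \<tau> * (\<Sum>k=1..Suc n. (X \<tau> \<bullet> e k)\<^sup>2) + exit_rate \<tau> * (X \<tau> \<bullet> e ?k)\<^sup>2"
    by (simp add: distrib_left)
  then show ?case
    unfolding split set_integral_add(2)[OF conjunct1[OF Suc] i]
    using set_integral_add(1)[OF conjunct1[OF Suc] i] conjunct2[OF Suc] higher_mode_cost_ge[of ?k]
    by linarith
qed

text \<open>Bessel's inequality bounds the cost of finitely many modes by the full cost, uniformly in their
  number, and Parseval's identity recovers the norm of the exit point in the limit.\<close>

lemma cost_ge:
  "exit_rate \<tau> * (norm (X \<tau>))\<^sup>2 \<le> (LINT s:{0..\<tau>}|lborel. (norm (v s))\<^sup>2 / 2 - (norm (u (X s)))\<^sup>2)"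
proof (rule LIMSEQ_le_const2)
  show "(\<lambda>n. exit_rate \<tau> * (\<Sum>k=1..Suc n. (X \<tau> \<bullet> e k)\<^sup>2)) \<longlonglongrightarrow> exit_rate \<tau> * (norm (X \<tau>))\<^sup>2"
    by (intro tendsto_intros LIMSEQ_Suc parseval basis)
  have i: "set_integrable lborel {0..\<tau>} (\<lambda>s. (norm (v s))\<^sup>2 / 2 - (norm (u (X s)))\<^sup>2)"
    using control unfolding L2_control_def
    by (intro set_integral_diff(1) set_integrable_divide set_integrable_until integrable_feedback_cost) auto
  have "exit_rate \<tau> * (\<Sum>k=1..Suc n. (X \<tau> \<bullet> e k)\<^sup>2) \<le>
      (LINT s:{0..\<tau>}|lborel. (norm (v s))\<^sup>2 / 2 - (norm (u (X s)))\<^sup>2)" for n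
  proof -
    have "(LINT s:{0..\<tau>}|lborel. (\<Sum>k=1..Suc n. (v s \<bullet> e k)\<^sup>2) / 2 - (norm (u (X s)))\<^sup>2) \<le>
        (LINT s:{0..\<tau>}|lborel. (norm (v s))\<^sup>2 / 2 - (norm (u (X s)))\<^sup>2)"
      by (rule set_integral_mono[OF conjunct1[OF finitely_many_modes_cost_ge] i])
        (intro diff_right_mono divide_right_mono bessel basis, simp)
    then show ?thesis
      using conjunct2[OF finitely_many_modes_cost_ge[of n]] by linarith
  qed
  then show "\<exists>N. \<forall>n\<ge>N. exit_rate \<tau> * (\<Sum>k=1..Suc n. (X \<tau> \<bullet> e k)\<^sup>2) \<le>
      (LINT s:{0..\<tau>}|lborel. (norm (v s))\<^sup>2 / 2 - (norm (u (X s)))\<^sup>2)"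
    by blast
qed

end

end

text \<open>Leaving before time $T$ or at a point outside the sphere only raises the lower bound for the cost.\<close>

lemma rate_functional_ge:
  assumes y: "y \<in> exit_paths T L" and L: "0 < L"
  shows "ereal (exit_rate T * L\<^sup>2) \<le> rate_functional T L S B u y"
proof (cases "\<exists>v. L2_control T v \<and> mild_solution T S B u v y")
  case True
  define v where "v = (SOME v. L2_control T v \<and> mild_solution T S B u v y)"
  have v: "L2_control T v" "mild_solution T S B u v y"
    using someI_ex[OF True] unfolding v_def by auto
  obtain \<tau> where \<tau>: "0 < \<tau>" "\<tau> \<le> T" "L \<le> norm (y \<tau>)"
    and set: "{s. 0 \<le> s \<and> s \<le> T \<and> ereal s \<le> exit_time T L y} = {0..\<tau>}"
    using exit_time_attained[OF y L] by metis
  have "exit_rate T * L\<^sup>2 \<le> exit_rate \<tau> * (norm (y \<tau>))\<^sup>2"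
    using \<tau> L by (intro mult_mono exit_rate_antimono exit_rate_nonneg power_mono) auto
  also have "\<dots> \<le> path_cost T L u v y"
    unfolding path_cost_def set by (rule cost_ge[OF v \<tau>(1,2)])
  finally show ?thesis
    using True by (simp add: rate_functional_def v_def)
next
  case False
  then show ?thesis
    by (simp only: rate_functional_def if_False ereal_less_eq)
qed


section \<open>The minimizing path\<close>

text \<open>
  The solution of $x'' = \alpha_1^2 x$ with $x(0) = 0$ and $x(T) = L$, which is the Euler--Lagrange
  equation of the first-mode cost, together with its forcing $x' + \alpha_1 x$. This forcing is
  proportional to the kernel $e^{-\alpha_1(T-s)}$, the case of equality in Cauchy--Schwarz.
\<close>

definition ramp :: "real \<Rightarrow> real \<Rightarrow> real \<Rightarrow> real" where
  "ramp T L t = L * sinh (\<alpha> 1 * t) / sinh (\<alpha> 1 * T)"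

definition ramp_forcing :: "real \<Rightarrow> real \<Rightarrow> real \<Rightarrow> real" where
  "ramp_forcing T L s = L * \<alpha> 1 / sinh (\<alpha> 1 * T) * exp (\<alpha> 1 * s)"

lemma ramp_duhamel:
  assumes "0 \<le> t"
  shows "(LINT s:{0..t}|lborel. exp (- \<alpha> 1 * (t - s)) * ramp_forcing T L s) = ramp T L t"
proof -
  have "exp (- \<alpha> 1 * (t - s)) * ramp_forcing T L s =
      L * \<alpha> 1 / sinh (\<alpha> 1 * T) * exp (- \<alpha> 1 * t) * exp (2 * \<alpha> 1 * s)" for s
    by (simp add: ramp_forcing_def algebra_simps flip: exp_add)
  then have "(LINT s:{0..t}|lborel. exp (- \<alpha> 1 * (t - s)) * ramp_forcing T L s) =
      L * \<alpha> 1 / sinh (\<alpha> 1 * T) * exp (- \<alpha> 1 * t) * ((exp (2 * \<alpha> 1 * t) - 1) / (2 * \<alpha> 1))"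
    using interval_integral_exp[of "2 * \<alpha> 1" t] alpha_pos[of 1] assms
    by (simp only: set_integral_mult_right) simp
  also have "\<dots> = L * \<alpha> 1 / sinh (\<alpha> 1 * T) * (exp (- \<alpha> 1 * t) * (exp (2 * \<alpha> 1 * t) - 1) / (2 * \<alpha> 1))"
    by simp
  also have "exp (- \<alpha> 1 * t) * (exp (2 * \<alpha> 1 * t) - 1) = 2 * sinh (\<alpha> 1 * t)"
    by (simp add: sinh_field_def right_diff_distrib flip: exp_add)
  also have "L * \<alpha> 1 / sinh (\<alpha> 1 * T) * (2 * sinh (\<alpha> 1 * t) / (2 * \<alpha> 1)) = ramp T L t"
    using alpha_pos[of 1] by (simp add: ramp_def)
  finally show ?thesis .
qed

lemma ramp_forcing_energy:
  assumes T: "0 < T"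
  shows "(LINT s:{0..T}|lborel. (ramp_forcing T L s)\<^sup>2) / 2 + \<alpha> 1 * L\<^sup>2 = (lam 1)\<^sup>2 * (exit_rate T * L\<^sup>2)"
proof -
  define q where "q = exp (\<alpha> 1 * T)"
  have a: "0 < \<alpha> 1" "0 < lam 1"
    by (simp_all add: alpha_pos lam_pos)
  have q: "q > 1"
    using a T by (simp add: q_def)
  then have q2: "q * q > 1"
    by (metis less_trans mult_less_cancel_left2 mult.right_neutral mult_strict_mono' zero_le_one)
  have s: "sinh (\<alpha> 1 * T) = (q * q - 1) / (2 * q)"
    using q by (simp add: sinh_field_def q_def exp_minus field_simps)
  have e1: "exp (2 * \<alpha> 1 * T) = q * q"
    unfolding q_def by (simp flip: exp_add)
  have e2: "exp (- 2 * \<alpha> 1 * T) = 1 / (q * q)"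
    unfolding e1[symmetric] by (simp add: exp_minus inverse_eq_divide)
  have "(ramp_forcing T L s)\<^sup>2 = (L * \<alpha> 1 / sinh (\<alpha> 1 * T))\<^sup>2 * exp (2 * \<alpha> 1 * s)" for s
    by (simp add: ramp_forcing_def power_mult_distrib power_divide exp_double mult.assoc)
  then have "(LINT s:{0..T}|lborel. (ramp_forcing T L s)\<^sup>2) =
      (L * \<alpha> 1 / sinh (\<alpha> 1 * T))\<^sup>2 * ((exp (2 * \<alpha> 1 * T) - 1) / (2 * \<alpha> 1))"
    using interval_integral_exp[of "2 * \<alpha> 1" T] a T by simp
  also have "\<dots> = (L * \<alpha> 1 * 2 * q / (q * q - 1))\<^sup>2 * ((q * q - 1) / (2 * \<alpha> 1))"
    unfolding s e1 by (simp add: divide_divide_eq_right mult.assoc)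
  also have "\<dots> = 2 * (\<alpha> 1 * (q * q) / (q * q - 1) * L\<^sup>2)"
  proof -
    have "(L * b * 2 * q / m)\<^sup>2 * (m / (2 * b)) = 2 * (b * (q * q) / m * L\<^sup>2)" if "b > 0" "m > 0" for b m :: real
      using that by (simp add: power2_eq_square field_simps)
    then show ?thesis
      using a(1) q2 by simp
  qed
  also have "\<alpha> 1 * (q * q) / (q * q - 1) = \<alpha> 1 / (1 - 1 / (q * q))"
    using q q2 by (simp add: field_simps)
  finally have "(LINT s:{0..T}|lborel. (ramp_forcing T L s)\<^sup>2) / 2 = \<alpha> 1 / (1 - 1 / (q * q)) * L\<^sup>2"
    by linarith
  moreover have "(lam 1)\<^sup>2 * (exit_rate T * L\<^sup>2) = (\<alpha> 1 / (1 - 1 / (q * q)) + \<alpha> 1) * L\<^sup>2"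
    using a(2) unfolding exit_rate_def e2 by simp
  ultimately show ?thesis
    by (simp only: distrib_right)
qed

lemma ramp_bounds:
  assumes "0 < T" "0 < L"
  shows "ramp T L 0 = 0" "ramp T L T = L" "\<And>t. 0 \<le> t \<Longrightarrow> t < T \<Longrightarrow> \<bar>ramp T L t\<bar> < L"
proof -
  have a: "0 < \<alpha> 1" by (simp add: alpha_pos)
  then have s: "0 < sinh (\<alpha> 1 * T)"
    using assms by simp
  show "ramp T L 0 = 0" "ramp T L T = L"
    using a assms by (simp_all add: ramp_def)
  fix t assume t: "0 \<le> t" "t < T"
  then have "0 \<le> sinh (\<alpha> 1 * t)" "sinh (\<alpha> 1 * t) < sinh (\<alpha> 1 * T)"
    using a by simp_all
  then show "\<bar>ramp T L t\<bar> < L"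
    using s assms by (simp add: ramp_def abs_mult pos_divide_less_eq)
qed

lemma continuous_ramp: "continuous_on A (ramp T L)"
  unfolding ramp_def divide_inverse by (intro continuous_intros)

text \<open>The control is recovered from the forcing by undoing the feedback: $v = w/\lambda_1 + u(X)$ in
  the first mode.\<close>

lemma ramp_controllable: "\<exists>v. L2_control T v \<and> mild_solution T S B u v (\<lambda>t. ramp T L t *\<^sub>R e 1)"
proof -
  define c where "c = (\<lambda>s. (ramp_forcing T L s + 2 * \<alpha> 1 * ramp T L s) / lam 1)"
  define v where "v = (\<lambda>s. c s *\<^sub>R e 1)"
  have cont: "continuous_on A v" for A
    unfolding v_def c_def ramp_forcing_def
    using lam_pos[of 1] by (intro continuous_intros continuous_ramp) auto
  have control: "L2_control T v"
    unfolding L2_control_def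
    using set_measurable_continuous_on[OF _ cont, of "{0..T}"]
    by (auto simp: set_borel_measurable_def intro!: borel_integrable_atLeastAtMost' continuous_intros cont)
  have vu: "v s - u (ramp T L s *\<^sub>R e 1) = (ramp_forcing T L s / lam 1) *\<^sub>R e 1" for s
    using basis_inner[OF basis, of 1 1]
    by (simp add: v_def c_def u_eq add_divide_distrib flip: scaleR_diff_left)
  have SB: "S (t - s) (B (v s - u (ramp T L s *\<^sub>R e 1))) =
      (exp (- \<alpha> 1 * (t - s)) * ramp_forcing T L s) *\<^sub>R e 1" if "s \<le> t" for s t
  proof -
    have "B (v s - u (ramp T L s *\<^sub>R e 1)) = ramp_forcing T L s *\<^sub>R e 1"
      unfolding vu using lam_pos[of 1] B_basis[of 1] linear_scale[OF bounded_linear.linear[OF B_linear]]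
      by simp
    then show ?thesis
      using that S_basis[of 1 "t - s"] linear_scale[OF bounded_linear.linear[OF S_linear[of "t - s"]]]
      by simp
  qed
  have "mild_solution T S B u v (\<lambda>t. ramp T L t *\<^sub>R e 1)"
    unfolding mild_solution_def
  proof (intro conjI ballI)
    show "continuous_on {0..T} (\<lambda>t. ramp T L t *\<^sub>R e 1)"
      by (intro continuous_intros continuous_ramp)
    fix t assume t: "t \<in> {0..T}"
    have "(LINT s:{0..t}|lborel. S (t - s) (B (v s - u (ramp T L s *\<^sub>R e 1)))) =
        (LINT s:{0..t}|lborel. (exp (- \<alpha> 1 * (t - s)) * ramp_forcing T L s) *\<^sub>R e 1)"
      by (rule set_lebesgue_integral_cong) (auto simp: SB simp del: One_nat_def)
    also have "\<dots> = (LINT s:{0..t}|lborel. exp (- \<alpha> 1 * (t - s)) * ramp_forcing T L s) *\<^sub>R e 1"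
    proof -
      have "set_integrable lborel {0..t} (\<lambda>s. exp (- \<alpha> 1 * (t - s)) * ramp_forcing T L s)"
        unfolding ramp_forcing_def by (intro borel_integrable_atLeastAtMost' continuous_intros)
      then show ?thesis
        unfolding set_lebesgue_integral_def set_integrable_def scaleR_scaleR real_scaleR_def
        by (rule integral_scaleR_left)
    qed
    also have "\<dots> = ramp T L t *\<^sub>R e 1"
      using ramp_duhamel[of t T L] t by simp
    finally show "ramp T L t *\<^sub>R e 1 = (LINT s:{0..t}|lborel. S (t - s) (B (v s - u (ramp T L s *\<^sub>R e 1))))" ..
  qed
  with control show ?thesis
    by blast
qed

text \<open>The path determines the forcing of every mode almost everywhere, and hence $|v|$: the higher modes of
  the control vanish and the forcing of the first mode is known. The exact identity for the first-mode
  cost then gives the value.\<close>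

lemma ramp_cost:
  assumes T: "0 < T" and L: "0 < L"
    and v: "L2_control T v" and mild: "mild_solution T S B u v (\<lambda>t. ramp T L t *\<^sub>R e 1)"
  shows "(LINT s:{0..T}|lborel. (norm (v s))\<^sup>2 / 2 - (norm (u (ramp T L s *\<^sub>R e 1)))\<^sup>2) = exit_rate T * L\<^sup>2"
proof -
  define X where "X = (\<lambda>t. ramp T L t *\<^sub>R e 1)"
  have mildX: "mild_solution T S B u v X"
    using mild by (simp add: X_def)
  note v_mild = v mildX
  have X_inner: "X t \<bullet> e k = (if k = 1 then ramp T L t else 0)" if "k \<ge> 1" for t k
    using that by (simp add: X_def basis_inner[OF basis])
  define w where "w = (\<lambda>k s. lam k * ((v s - u (X s)) \<bullet> e k))"
  have wi: "set_integrable lborel {0..T} (w k)" for k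
    unfolding w_def by (rule integrable_mode_forcing[OF v_mild])
  have mode: "X t \<bullet> e k = (LINT s:{0..t}|lborel. exp (- \<alpha> k * (t - s)) * w k s)"
    if "0 \<le> t" "t \<le> T" "k \<ge> 1" for t k
    using mild_mode[OF v_mild that] by (simp add: w_def)
  have first: "AE s in lborel. s \<in> {0..T} \<longrightarrow> w 1 s - ramp_forcing T L s = 0"
  proof (rule convolution_zero_imp_AE_zero[where c = "\<alpha> 1"])
    have fi: "set_integrable lborel {0..T} (ramp_forcing T L)"
      unfolding ramp_forcing_def by (intro borel_integrable_atLeastAtMost' continuous_intros)
    show "set_integrable lborel {0..T} (\<lambda>s. w 1 s - ramp_forcing T L s)"
      by (intro set_integral_diff(1) wi fi)
    fix t assume t: "0 \<le> t" "t \<le> T"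
    have i: "set_integrable lborel {0..t} (\<lambda>s. exp (- \<alpha> 1 * (t - s)) * f s)"
      if "set_integrable lborel {0..T} f" for f
      by (intro set_integrable_continuous_mult continuous_intros set_integrable_subset[OF that])
        (use t in auto)
    have "(LINT s:{0..t}|lborel. exp (- \<alpha> 1 * (t - s)) * (w 1 s - ramp_forcing T L s)) =
        (LINT s:{0..t}|lborel. exp (- \<alpha> 1 * (t - s)) * w 1 s) -
        (LINT s:{0..t}|lborel. exp (- \<alpha> 1 * (t - s)) * ramp_forcing T L s)"
      unfolding right_diff_distrib[of "exp y" for y] by (rule set_integral_diff(2)) (rule i wi fi)+
    also have "\<dots> = 0"
      unfolding ramp_duhamel[OF t(1)] mode[OF t order_refl, symmetric] by (simp add: X_inner)
    finally show "(LINT s:{0..t}|lborel. exp (- \<alpha> 1 * (t - s)) * (w 1 s - ramp_forcing T L s)) = 0" .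
  qed
  have higher: "AE s in lborel. \<forall>k\<in>{2..}. s \<in> {0..T} \<longrightarrow> v s \<bullet> e k = 0"
  proof (rule AE_ball_countable')
    fix k :: nat assume "k \<in> {2..}"
    then have k: "k \<ge> 2" "k \<ge> 1" by auto
    have "AE s in lborel. s \<in> {0..T} \<longrightarrow> w k s = 0"
      by (rule convolution_zero_imp_AE_zero[OF wi, where c = "\<alpha> k"])
        (use k mode[OF _ _ k(2)] X_inner[OF k(2)] in auto)
    then show "AE s in lborel. s \<in> {0..T} \<longrightarrow> v s \<bullet> e k = 0"
      by eventually_elim
        (use k lam_pos[OF k(2)] u_inner[OF k(2)] in \<open>auto simp: w_def inner_diff_left\<close>)
  qed auto
  have norm_v: "(norm (v s))\<^sup>2 = (v s \<bullet> e 1)\<^sup>2" if "\<forall>k\<in>{2..}. v s \<bullet> e k = 0" for s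
  proof (rule LIMSEQ_unique[OF LIMSEQ_Suc[OF parseval[OF basis]]])
    have "(\<Sum>k=1..Suc n. (v s \<bullet> e k)\<^sup>2) = (v s \<bullet> e 1)\<^sup>2" for n
      using that by (induction n) auto
    then show "(\<lambda>n. \<Sum>k=1..Suc n. (v s \<bullet> e k)\<^sup>2) \<longlonglongrightarrow> (v s \<bullet> e 1)\<^sup>2"
      by (simp only: tendsto_const)
  qed
  have "(lam 1)\<^sup>2 * (LINT s:{0..T}|lborel. (norm (v s))\<^sup>2 / 2 - (norm (u (X s)))\<^sup>2) =
      (lam 1)\<^sup>2 * (LINT s:{0..T}|lborel. (v s \<bullet> e 1)\<^sup>2 / 2 - (norm (u (X s)))\<^sup>2)"
  proof -
    have "set_integrable lborel {0..T} (\<lambda>s. (norm (v s))\<^sup>2 / 2 - (norm (u (X s)))\<^sup>2)"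
      "set_integrable lborel {0..T} (\<lambda>s. (v s \<bullet> e 1)\<^sup>2 / 2 - (norm (u (X s)))\<^sup>2)"
      using v unfolding L2_control_def
      by (intro set_integral_diff(1) set_integrable_divide integrable_feedback_cost[OF v_mild]
          L2_control_inner_square[OF v]; simp)+
    then have "(LINT s:{0..T}|lborel. (norm (v s))\<^sup>2 / 2 - (norm (u (X s)))\<^sup>2) =
      (LINT s:{0..T}|lborel. (v s \<bullet> e 1)\<^sup>2 / 2 - (norm (u (X s)))\<^sup>2)"
      unfolding set_lebesgue_integral_def set_integrable_def
    proof (intro integral_cong_AE borel_measurable_integrable)
      show "AE s in lborel. indicat_real {0..T} s *\<^sub>R ((norm (v s))\<^sup>2 / 2 - (norm (u (X s)))\<^sup>2) =
          indicat_real {0..T} s *\<^sub>R ((v s \<bullet> e 1)\<^sup>2 / 2 - (norm (u (X s)))\<^sup>2)"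
        using higher
      proof eventually_elim
        case (elim s)
        then show ?case
          by (cases "s \<in> {0..T}") (auto simp: norm_v simp del: One_nat_def)
      qed
    qed
    then show ?thesis by simp
  qed
  also have "\<dots> = (LINT s:{0..T}|lborel. (w 1 s)\<^sup>2) / 2 + \<alpha> 1 * (X T \<bullet> e 1)\<^sup>2"
    unfolding w_def by (rule first_mode_cost[OF v_mild T order_refl])
  also have "(LINT s:{0..T}|lborel. (w 1 s)\<^sup>2) = (LINT s:{0..T}|lborel. (ramp_forcing T L s)\<^sup>2)"
    unfolding set_lebesgue_integral_def
  proof (intro integral_cong_AE borel_measurable_integrable)
    show "integrable lborel (\<lambda>s. indicat_real {0..T} s *\<^sub>R (w 1 s)\<^sup>2)"
      using integrable_first_forcing_square[OF v_mild] by (simp only: w_def set_integrable_def)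
    have "set_integrable lborel {0..T} (\<lambda>s. (ramp_forcing T L s)\<^sup>2)"
      unfolding ramp_forcing_def by (intro borel_integrable_atLeastAtMost' continuous_intros)
    then show "integrable lborel (\<lambda>s. indicat_real {0..T} s *\<^sub>R (ramp_forcing T L s)\<^sup>2)"
      by (simp only: set_integrable_def)
    show "AE s in lborel. indicat_real {0..T} s *\<^sub>R (w 1 s)\<^sup>2 =
        indicat_real {0..T} s *\<^sub>R (ramp_forcing T L s)\<^sup>2"
      using first by eventually_elim (simp add: indicator_def)
  qed
  also have "X T \<bullet> e 1 = L"
    using X_inner[of 1 T] ramp_bounds(2)[OF T L] by simp
  also have "(LINT s:{0..T}|lborel. (ramp_forcing T L s)\<^sup>2) / 2 + \<alpha> 1 * L\<^sup>2 = (lam 1)\<^sup>2 * (exit_rate T * L\<^sup>2)"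
    by (rule ramp_forcing_energy[OF T])
  finally show ?thesis
    using lam_pos[of 1] by (simp add: X_def)
qed

lemma norm_ramp: "norm (ramp T L t *\<^sub>R e 1) = \<bar>ramp T L t\<bar>"
  using norm_e1 by simp

lemma ramp_exit_path:
  assumes "0 < T" "0 < L"
  shows "(\<lambda>t. ramp T L t *\<^sub>R e 1) \<in> exit_paths T L"
  unfolding exit_paths_def mem_Collect_eq norm_ramp
  using ramp_bounds(1,2)[OF assms] assms
  by (intro conjI continuous_intros continuous_ramp) (auto intro!: bexI[of _ T])

lemma rate_functional_ramp:
  assumes T: "0 < T" and L: "0 < L"
  shows "rate_functional T L S B u (\<lambda>t. ramp T L t *\<^sub>R e 1) = ereal (exit_rate T * L\<^sup>2)"
proof -
  let ?y = "\<lambda>t. ramp T L t *\<^sub>R e 1"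
  define v where "v = (SOME v. L2_control T v \<and> mild_solution T S B u v ?y)"
  have v: "L2_control T v" "mild_solution T S B u v ?y"
    using someI_ex[OF ramp_controllable] unfolding v_def by auto
  obtain \<tau> where \<tau>: "0 < \<tau>" "\<tau> \<le> T" "L \<le> norm (?y \<tau>)"
    and set: "{s. 0 \<le> s \<and> s \<le> T \<and> ereal s \<le> exit_time T L ?y} = {0..\<tau>}"
    by (rule exit_time_attained[OF ramp_exit_path[OF T L] L])
  have "\<tau> = T"
    using \<tau> ramp_bounds(3)[OF T L, of \<tau>] unfolding norm_ramp by linarith
  then have "path_cost T L u v ?y = exit_rate T * L\<^sup>2"
    unfolding path_cost_def set using ramp_cost[OF T L v] by simp
  then show ?thesis
    using ramp_controllable unfolding rate_functional_def v_def by simp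
qed

end

theorem theorem3p4:
  fixes e :: "nat \<Rightarrow> 'a::{real_inner, banach, second_countable_topology}"
    and D :: "'a set" and A B u :: "'a \<Rightarrow> 'a" and S :: "real \<Rightarrow> 'a \<Rightarrow> 'a"
    and \<alpha> lam :: "nat \<Rightarrow> real" and L T :: real
  assumes "complete_orthonormal_basis e"
    and "self_adjoint_op D A" and "unbounded_op D A"
    and "\<And>k. k \<ge> 1 \<Longrightarrow> e k \<in> D \<and> A (e k) = - \<alpha> k *\<^sub>R e k"
    and "0 < \<alpha> 1" and "\<And>k. k \<ge> 1 \<Longrightarrow> \<alpha> k \<le> \<alpha> (Suc k)"
    and "generates_semigroup D A S"
    and "\<And>k t. k \<ge> 1 \<Longrightarrow> t \<ge> 0 \<Longrightarrow> S t (e k) = exp (- \<alpha> k * t) *\<^sub>R e k"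
    and "bounded_linear B" and "\<And>k. k \<ge> 1 \<Longrightarrow> B (e k) = lam k *\<^sub>R e k"
    and "\<And>k. k \<ge> 1 \<Longrightarrow> 0 < lam k"
    and "(\<lambda>k. (lam k)\<^sup>2 / \<alpha> k) summable_on {1..}"
    and "0 < L"
    and "u = (\<lambda>x. (2 * \<alpha> 1 / lam 1 * (x \<bullet> e 1)) *\<^sub>R e 1)"
    and "\<And>k. k \<ge> 2 \<Longrightarrow> lam k \<le> lam 1 \<and> 3 * \<alpha> 1 < \<alpha> k"
    and "0 < T"
  shows "\<exists>y \<in> exit_paths T L.
           rate_functional T L S B u y = (INF z \<in> exit_paths T L. rate_functional T L S B u z) \<and>
           (\<forall>t. 0 \<le> t \<and> t < T \<longrightarrow> norm (y t) < L) \<and> norm (y T) = L \<and>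
           (\<forall>t\<in>{0..T}. \<forall>k\<ge>2. y t \<bullet> e k = 0)"
proof -
  have alpha_pos: "0 < \<alpha> k" if "k \<ge> 1" for k
  proof (cases "k = 1")
    case False
    then have "3 * \<alpha> 1 < \<alpha> k"
      using assms(15) that by simp
    then show ?thesis
      using assms(5) by linarith
  qed (use assms(5) in simp)
  have S_linear: "bounded_linear (S t)" if "t \<ge> 0" for t
    using assms(7) that by (simp add: generates_semigroup_def)
  interpret feedback_system e S B \<alpha> lam u
    by (intro feedback_system.intro diagonal_system.intro feedback_system_axioms.intro
        assms alpha_pos S_linear)
  define y where "y = (\<lambda>t. ramp T L t *\<^sub>R e 1)"
  have y: "y \<in> exit_paths T L"
    unfolding y_def by (rule ramp_exit_path[OF \<open>0 < T\<close> \<open>0 < L\<close>])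
  have cost: "rate_functional T L S B u y = ereal (exit_rate T * L\<^sup>2)"
    unfolding y_def by (rule rate_functional_ramp[OF \<open>0 < T\<close> \<open>0 < L\<close>])
  show ?thesis
  proof (intro bexI[of _ y] conjI allI impI ballI)
    show "rate_functional T L S B u y = (INF z \<in> exit_paths T L. rate_functional T L S B u z)"
    proof (rule antisym)
      show "rate_functional T L S B u y \<le> (INF z \<in> exit_paths T L. rate_functional T L S B u z)"
        unfolding cost using \<open>0 < L\<close> by (intro INF_greatest rate_functional_ge)
    qed (rule INF_lower[OF y])
    show "norm (y t) < L" if "0 \<le> t \<and> t < T" for t
      unfolding y_def norm_ramp using that ramp_bounds(3)[OF \<open>0 < T\<close> \<open>0 < L\<close>] by blast
    show "norm (y T) = L"
      unfolding y_def norm_ramp using ramp_bounds(2)[OF \<open>0 < T\<close> \<open>0 < L\<close>] \<open>0 < L\<close> by simp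
    show "y t \<bullet> e k = 0" if "2 \<le> k" for t k
      using that basis_inner[OF basis, of 1 k] by (simp add: y_def)
  qed (rule y)
qed

end
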